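(* Let $G$ be a finite group, let $\mathsf{C}$ be a finite category with skeletal Möbius inversion, and let $F:\mathsf{C}\to G\text{-}\mathsf{set}$ be a functor to the category of finite $G$-sets. Then the $G$-category $\int_{\mathsf{C}}F$ has series Lefschetz invariant given by $$\Lambda_{\Sigma}\Big(\int_{\mathsf{C}}F\Big)=\sum_{x\in\mathrm{Obj}(\mathsf{C})}k_{\mathsf{C}}(x)\,[F(x)]\ \in\ \Omega(G),$$ where $k_{\mathsf{C}}$ is the skeletal weighting on $\mathsf{C}$ and $[F(x)]$ is the class of the $G$-set $F(x)$ in $\Omega(G)$.
   Context: A finite category has finitely many objects and finitely many morphisms. $\mathbb{M}_{\mathsf{C}}(\mathbb{Q})$ is the $\mathbb{Q}$-algebra of functions $\mathrm{Obj}\,\mathsf{C}\times\mathrm{Obj}\,\mathsf{C}\to\mathbb{Q}$ with product $\alpha\beta(x,y)=\sum_z\alpha(x,z)\beta(z,y)$. Let $\zeta_{\mathsf{C}}(x,y)=|\mathsf{C}(x,y)|$, and let $e=e_{\mathsf{C}}$ be the idempotent with $e(x,y)=1/|[x]|$ if $x\cong y$ (where $|[x]|$ is the number of objects isomorphic to $x$) and $0$ otherwise. One has $\zeta_{\mathsf{C}}\in e\mathbb{M}_{\mathsf{C}}(\mathbb{Q})e$; $\mathsf{C}$ has skeletal Möbius inversion if $\zeta_{\mathsf{C}}$ is invertible in the algebra $e\mathbb{M}_{\mathsf{C}}(\mathbb{Q})e$ (with identity $e$). In that case there is a unique function $k_{\mathsf{C}}:\mathrm{Obj}(\mathsf{C})\to\mathbb{Q}$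 that is constant on isomorphism classes and satisfies $\sum_y|\mathsf{C}(x,y)|k_{\mathsf{C}}(y)=1$ for all $x$; it is called the skeletal weighting. The Grothendieck construction $\int_{\mathsf{C}}F$ has objects $(x,a)$ with $x\in\mathrm{Obj}(\mathsf{C})$, $a\in F(x)$; morphisms $(x,a)\to(y,b)$ are the morphisms $\varphi:x\to y$ in $\mathsf{C}$ with $F(\varphi)(a)=b$. $G$ acts by $g\cdot(x,a)=(x,ga)$ on objects and $g\cdot(\varphi,a)=(\varphi,ga)$ on morphisms, where $(\varphi,a)$ denotes the morphism $\varphi$ with source $(x,a)$. $\Omega(G)=\mathbb{Q}\otimes_{\mathbb{Z}}\Omega_{\mathbb{Z}}(G)$ is the rational Burnside ring. Series Lefschetz invariant: for a finite category $\mathsf{D}$ with a $G$-action, let $\mathsf{D}_n$ be the finite $G$-set of chains of $n$ composable non-identity morphisms ($\mathsf{D}_0=\mathrm{Obj}(\mathsf{D})$), and $f_{\mathsf{D}}(t)=\sum_{n\ge0}[\mathsf{D}_n]t^n\in\Omega(G)[[t]]\cong\Omega(G)\otimes_{\mathbb{Q}}\mathbb{Q}[[t]]$. Let $\mathbb{Q}[t]_{(t+1)}$ be the ring of rational functions $p/q$ with $(t+1)\nmid q$. $\mathsf{D}$ has series Lefschetz invariant if $f_{\mathsf{D}}\in\Omega(G)\otimes_{\mathbb{Q}}\mathbb{Q}[t]_{(t+1)}$ (compared inside Laurent series), and then $\Lambda_{\Sigma}(\mathsf{D}):=f_{\mathsf{D}}(-1)$. *)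

theory Defs
  imports
    "HOL-Algebra.Group_Action"
    "HOL-Algebra.AbelCoset"
    "HOL-Algebra.Module"
    "HOL-Library.FuncSet"
    "HOL-Library.Nat_Bijection"
    "HOL-Library.Poly_Mapping"
    "HOL-Computational_Algebra.Polynomial_FPS"
    "HOL-Computational_Algebra.Formal_Laurent_Series"
begin

section \<open>Finite categories and skeletal Moebius inversion\<close>

text \<open>\<open>cmp C g f\<close> is the composite "g after f"; it is only meaningful when \<open>tgt C f = src C g\<close>.\<close>

record ('o, 'm) cat =
  obj :: "'o set"
  mor :: "'m set"
  src :: "'m \<Rightarrow> 'o"
  tgt :: "'m \<Rightarrow> 'o"
  idt :: "'o \<Rightarrow> 'm"
  cmp :: "'m \<Rightarrow> 'm \<Rightarrow> 'm"

locale category =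
  fixes C :: "('o, 'm, 'z) cat_scheme"
  assumes src_obj: "f \<in> mor C \<Longrightarrow> src C f \<in> obj C"
    and tgt_obj: "f \<in> mor C \<Longrightarrow> tgt C f \<in> obj C"
    and idt_mor: "x \<in> obj C \<Longrightarrow> idt C x \<in> mor C"
    and src_idt: "x \<in> obj C \<Longrightarrow> src C (idt C x) = x"
    and tgt_idt: "x \<in> obj C \<Longrightarrow> tgt C (idt C x) = x"
    and cmp_mor: "\<lbrakk>f \<in> mor C; g \<in> mor C; tgt C f = src C g\<rbrakk> \<Longrightarrow> cmp C g f \<in> mor C"
    and src_cmp: "\<lbrakk>f \<in> mor C; g \<in> mor C; tgt C f = src C g\<rbrakk> \<Longrightarrow> src C (cmp C g f) = src C f"
    and tgt_cmp: "\<lbrakk>f \<in> mor C; g \<in> mor C; tgt C f = src C g\<rbrakk> \<Longrightarrow> tgt C (cmp C g f) = tgt C g"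
    and cmp_idt_left: "f \<in> mor C \<Longrightarrow> cmp C (idt C (tgt C f)) f = f"
    and cmp_idt_right: "f \<in> mor C \<Longrightarrow> cmp C f (idt C (src C f)) = f"
    and cmp_assoc: "\<lbrakk>f \<in> mor C; g \<in> mor C; h \<in> mor C; tgt C f = src C g; tgt C g = src C h\<rbrakk>
      \<Longrightarrow> cmp C h (cmp C g f) = cmp C (cmp C h g) f"

locale finite_category = category +
  assumes finite_obj: "finite (obj C)"
    and finite_mor: "finite (mor C)"

definition homset :: "('o, 'm, 'z) cat_scheme \<Rightarrow> 'o \<Rightarrow> 'o \<Rightarrow> 'm set" where
  "homset C x y = {f \<in> mor C. src C f = x \<and> tgt C f = y}"

definition iso_objs :: "('o, 'm, 'z) cat_scheme \<Rightarrow> 'o \<Rightarrow> 'o \<Rightarrow> bool" where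
  "iso_objs C x y \<longleftrightarrow> x \<in> obj C \<and> y \<in> obj C \<and>
     (\<exists>f \<in> homset C x y. \<exists>g \<in> homset C y x. cmp C g f = idt C x \<and> cmp C f g = idt C y)"

definition iso_class :: "('o, 'm, 'z) cat_scheme \<Rightarrow> 'o \<Rightarrow> 'o set" where
  "iso_class C x = {y. iso_objs C x y}"

text \<open>The algebra \<open>M_C(Q)\<close>: functions on \<open>obj C \<times> obj C\<close>, taken \<open>undefined\<close> elsewhere.\<close>

definition matrix_algebra :: "('o, 'm, 'z) cat_scheme \<Rightarrow> (rat, 'o \<times> 'o \<Rightarrow> rat) module" where
  "matrix_algebra C =
    \<lparr>carrier = obj C \<times> obj C \<rightarrow>\<^sub>E UNIV,
     monoid.mult = (\<lambda>\<alpha> \<beta>. \<lambda>(x, y) \<in> obj C \<times> obj C. \<Sum>z \<in> obj C. \<alpha> (x, z) * \<beta> (z, y)),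
     one = (\<lambda>(x, y) \<in> obj C \<times> obj C. if x = y then 1 else 0),
     zero = (\<lambda>_ \<in> obj C \<times> obj C. 0),
     add = (\<lambda>\<alpha> \<beta>. \<lambda>p \<in> obj C \<times> obj C. \<alpha> p + \<beta> p),
     module.smult = (\<lambda>c \<alpha>. \<lambda>p \<in> obj C \<times> obj C. c * \<alpha> p)\<rparr>"

definition zeta :: "('o, 'm, 'z) cat_scheme \<Rightarrow> 'o \<times> 'o \<Rightarrow> rat" where
  "zeta C = (\<lambda>(x, y) \<in> obj C \<times> obj C. of_nat (card (homset C x y)))"

definition iso_idempotent :: "('o, 'm, 'z) cat_scheme \<Rightarrow> 'o \<times> 'o \<Rightarrow> rat" where
  "iso_idempotent C =
    (\<lambda>(x, y) \<in> obj C \<times> obj C. if iso_objs C x y then 1 / of_nat (card (iso_class C x)) else 0)"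

definition corner_algebra ::
    "('a, 'b, 'z) module_scheme \<Rightarrow> 'b \<Rightarrow> ('a, 'b, 'z) module_scheme" where
  "corner_algebra A e =
    A\<lparr>carrier := {e \<otimes>\<^bsub>A\<^esub> \<alpha> \<otimes>\<^bsub>A\<^esub> e | \<alpha>. \<alpha> \<in> carrier A}, one := e\<rparr>"

definition has_skeletal_Moebius_inversion :: "('o, 'm, 'z) cat_scheme \<Rightarrow> bool" where
  "has_skeletal_Moebius_inversion C \<longleftrightarrow>
     zeta C \<in> Units (corner_algebra (matrix_algebra C) (iso_idempotent C))"

definition is_skeletal_weighting :: "('o, 'm, 'z) cat_scheme \<Rightarrow> ('o \<Rightarrow> rat) \<Rightarrow> bool" where
  "is_skeletal_weighting C k \<longleftrightarrow>
     k \<in> obj C \<rightarrow>\<^sub>E UNIV \<and>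
     (\<forall>x y. iso_objs C x y \<longrightarrow> k x = k y) \<and>
     (\<forall>x \<in> obj C. (\<Sum>y \<in> obj C. of_nat (card (homset C x y)) * k y) = 1)"

definition skeletal_weighting :: "('o, 'm, 'z) cat_scheme \<Rightarrow> 'o \<Rightarrow> rat" where
  "skeletal_weighting C = (THE k. is_skeletal_weighting C k)"


section \<open>The rational Burnside ring\<close>

definition finite_gset :: "('g, 'z) monoid_scheme \<Rightarrow> 'x set \<Rightarrow> ('g \<Rightarrow> 'x \<Rightarrow> 'x) \<Rightarrow> bool" where
  "finite_gset G E \<phi> \<longleftrightarrow> group_action G E \<phi> \<and> finite E"

definition equivariant :: "('g, 'z) monoid_scheme \<Rightarrow> 'x set \<Rightarrow> ('g \<Rightarrow> 'x \<Rightarrow> 'x) \<Rightarrow>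
    'y set \<Rightarrow> ('g \<Rightarrow> 'y \<Rightarrow> 'y) \<Rightarrow> ('x \<Rightarrow> 'y) \<Rightarrow> bool" where
  "equivariant G E \<phi> E' \<psi> f \<longleftrightarrow>
     f \<in> E \<rightarrow> E' \<and> (\<forall>g \<in> carrier G. \<forall>x \<in> E. f (\<phi> g x) = \<psi> g (f x))"

definition gset_isomorphic :: "('g, 'z) monoid_scheme \<Rightarrow> 'x set \<Rightarrow> ('g \<Rightarrow> 'x \<Rightarrow> 'x) \<Rightarrow>
    'y set \<Rightarrow> ('g \<Rightarrow> 'y \<Rightarrow> 'y) \<Rightarrow> bool" where
  "gset_isomorphic G E \<phi> E' \<psi> \<longleftrightarrow> (\<exists>f. bij_betw f E E' \<and> equivariant G E \<phi> E' \<psi> f)"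

text \<open>
  Every finite \<open>G\<close>-set is isomorphic to one whose underlying set consists of natural numbers,
  so \<open>\<Omega>(G)\<close> is presented as the rational vector space generated by these, modulo
  \<open>[X] = [Y]\<close> for isomorphic \<open>X\<close> and \<open>Y\<close>, and \<open>[X \<squnion> Y] = [X] + [Y]\<close>. As tensoring with \<open>\<rat>\<close> is
  right exact, this is \<open>\<rat> \<otimes> \<Omega>\<^sub>\<int>(G)\<close>, where \<open>\<Omega>\<^sub>\<int>(G)\<close> is the Grothendieck ring presented by the same
  generators and relations over the integers. The product is induced by the cartesian product.
\<close>

type_synonym 'g nat_gset = "nat set \<times> ('g \<Rightarrow> nat \<Rightarrow> nat)"

definition nat_gsets :: "('g, 'z) monoid_scheme \<Rightarrow> 'g nat_gset set" where
  "nat_gsets G = {(E, \<phi>). finite_gset G E \<phi>}"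

definition gset_prod :: "'g nat_gset \<Rightarrow> 'g nat_gset \<Rightarrow> 'g nat_gset" where
  "gset_prod X Y =
    (prod_encode ` (fst X \<times> fst Y),
     \<lambda>g. \<lambda>n \<in> prod_encode ` (fst X \<times> fst Y).
       prod_encode (map_prod (snd X g) (snd Y g) (prod_decode n)))"

definition gset_point :: "'g nat_gset" where
  "gset_point = ({0}, \<lambda>g. \<lambda>n \<in> {0}. n)"

definition free_mult ::
    "('g nat_gset \<Rightarrow>\<^sub>0 rat) \<Rightarrow> ('g nat_gset \<Rightarrow>\<^sub>0 rat) \<Rightarrow> ('g nat_gset \<Rightarrow>\<^sub>0 rat)" where
  "free_mult v w = (\<Sum>X \<in> Poly_Mapping.keys v. \<Sum>Y \<in> Poly_Mapping.keys w.
     Poly_Mapping.single (gset_prod X Y) (Poly_Mapping.lookup v X * Poly_Mapping.lookup w Y))"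

text \<open>
  As the product of \<open>G\<close>-sets is associative, commutative and unital only up to isomorphism, this
  is not a ring; its quotient \<open>burnside_ring\<close> is.
\<close>

definition free_gset_module :: "('g, 'z) monoid_scheme \<Rightarrow> (rat, 'g nat_gset \<Rightarrow>\<^sub>0 rat) module" where
  "free_gset_module G =
    \<lparr>carrier = {v. Poly_Mapping.keys v \<subseteq> nat_gsets G},
     monoid.mult = free_mult,
     one = Poly_Mapping.single gset_point 1,
     zero = 0,
     add = (+),
     module.smult = (\<lambda>c. Poly_Mapping.map ((*) c))\<rparr>"

inductive_set burnside_relations ::
    "('g, 'z) monoid_scheme \<Rightarrow> ('g nat_gset \<Rightarrow>\<^sub>0 rat) set" for G where
  zero: "0 \<in> burnside_relations G"
| add: "\<lbrakk>v \<in> burnside_relations G; w \<in> burnside_relations G\<rbrakk> \<Longrightarrow> v + w \<in> burnside_relations G"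
| scale: "v \<in> burnside_relations G \<Longrightarrow> Poly_Mapping.map ((*) c) v \<in> burnside_relations G"
| iso: "\<lbrakk>(E, \<phi>) \<in> nat_gsets G; (E', \<psi>) \<in> nat_gsets G; gset_isomorphic G E \<phi> E' \<psi>\<rbrakk>
    \<Longrightarrow> Poly_Mapping.single (E, \<phi>) 1 - Poly_Mapping.single (E', \<psi>) 1 \<in> burnside_relations G"
| disjoint_union: "\<lbrakk>(E, \<phi>) \<in> nat_gsets G; (E\<^sub>1, \<phi>\<^sub>1) \<in> nat_gsets G; (E\<^sub>2, \<phi>\<^sub>2) \<in> nat_gsets G;
      E = E\<^sub>1 \<union> E\<^sub>2; E\<^sub>1 \<inter> E\<^sub>2 = {};
      \<And>g x. \<lbrakk>g \<in> carrier G; x \<in> E\<^sub>1\<rbrakk> \<Longrightarrow> \<phi> g x = \<phi>\<^sub>1 g x;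
      \<And>g x. \<lbrakk>g \<in> carrier G; x \<in> E\<^sub>2\<rbrakk> \<Longrightarrow> \<phi> g x = \<phi>\<^sub>2 g x\<rbrakk>
    \<Longrightarrow> Poly_Mapping.single (E, \<phi>) 1 - Poly_Mapping.single (E\<^sub>1, \<phi>\<^sub>1) 1
          - Poly_Mapping.single (E\<^sub>2, \<phi>\<^sub>2) 1 \<in> burnside_relations G"

type_synonym 'g burnside = "('g nat_gset \<Rightarrow>\<^sub>0 rat) set"

abbreviation burnside_coset :: "('g, 'z) monoid_scheme \<Rightarrow> ('g nat_gset \<Rightarrow>\<^sub>0 rat) \<Rightarrow> 'g burnside" where
  "burnside_coset G v \<equiv> burnside_relations G +>\<^bsub>free_gset_module G\<^esub> v"

definition burnside_ring :: "('g, 'z) monoid_scheme \<Rightarrow> (rat, 'g burnside) module" where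
  "burnside_ring G =
    \<lparr>carrier = a_rcosets\<^bsub>free_gset_module G\<^esub> (burnside_relations G),
     monoid.mult = (\<lambda>A B. \<Union>a \<in> A. \<Union>b \<in> B. burnside_coset G (a \<otimes>\<^bsub>free_gset_module G\<^esub> b)),
     one = burnside_coset G \<one>\<^bsub>free_gset_module G\<^esub>,
     zero = burnside_relations G,
     add = set_add (free_gset_module G),
     module.smult = (\<lambda>c A. \<Union>a \<in> A. burnside_coset G (c \<odot>\<^bsub>free_gset_module G\<^esub> a))\<rparr>"

text \<open>The class in \<open>\<Omega>(G)\<close> of a finite \<open>G\<close>-set on a carrier of any type.\<close>

definition burnside_class ::
    "('g, 'z) monoid_scheme \<Rightarrow> 'x set \<Rightarrow> ('g \<Rightarrow> 'x \<Rightarrow> 'x) \<Rightarrow> 'g burnside" where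
  "burnside_class G E \<phi> = burnside_coset G (Poly_Mapping.single
     (SOME X. X \<in> nat_gsets G \<and> gset_isomorphic G E \<phi> (fst X) (snd X)) 1)"


section \<open>Categories with a group action\<close>

record ('o, 'm, 'g) gcat = "('o, 'm) cat" +
  obj_act :: "'g \<Rightarrow> 'o \<Rightarrow> 'o"
  mor_act :: "'g \<Rightarrow> 'm \<Rightarrow> 'm"

locale gcategory = G?: group G + D?: category D
  for G :: "('g, 'y) monoid_scheme" (structure) and D :: "('o, 'm, 'g, 'z) gcat_scheme" +
  assumes obj_action: "group_action G (obj D) (obj_act D)"
    and mor_action: "group_action G (mor D) (mor_act D)"
    and src_act: "\<lbrakk>g \<in> carrier G; f \<in> mor D\<rbrakk> \<Longrightarrow> src D (mor_act D g f) = obj_act D g (src D f)"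
    and tgt_act: "\<lbrakk>g \<in> carrier G; f \<in> mor D\<rbrakk> \<Longrightarrow> tgt D (mor_act D g f) = obj_act D g (tgt D f)"
    and idt_act: "\<lbrakk>g \<in> carrier G; x \<in> obj D\<rbrakk> \<Longrightarrow> mor_act D g (idt D x) = idt D (obj_act D g x)"
    and cmp_act: "\<lbrakk>g \<in> carrier G; f \<in> mor D; f' \<in> mor D; tgt D f = src D f'\<rbrakk>
      \<Longrightarrow> mor_act D g (cmp D f' f) = cmp D (mor_act D g f') (mor_act D g f)"

text \<open>Functors from \<open>C\<close> to finite \<open>G\<close>-sets.\<close>

record ('o, 'm, 'g, 'a) gset_functor =
  fobj :: "'o \<Rightarrow> 'a set"
  fobj_act :: "'o \<Rightarrow> 'g \<Rightarrow> 'a \<Rightarrow> 'a"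
  fmor :: "'m \<Rightarrow> 'a \<Rightarrow> 'a"

locale functor_to_finite_gsets = G?: group G + C?: category C
  for G :: "('g, 'y) monoid_scheme" (structure) and C :: "('o, 'm, 'z) cat_scheme"
  and F :: "('o, 'm, 'g, 'a, 'w) gset_functor_scheme" +
  assumes fobj_gset: "x \<in> obj C \<Longrightarrow> finite_gset G (fobj F x) (fobj_act F x)"
    and fmor_equivariant: "f \<in> mor C \<Longrightarrow>
      equivariant G (fobj F (src C f)) (fobj_act F (src C f)) (fobj F (tgt C f)) (fobj_act F (tgt C f)) (fmor F f)"
    and fmor_idt: "\<lbrakk>x \<in> obj C; a \<in> fobj F x\<rbrakk> \<Longrightarrow> fmor F (idt C x) a = a"
    and fmor_cmp: "\<lbrakk>f \<in> mor C; g \<in> mor C; tgt C f = src C g; a \<in> fobj F (src C f)\<rbrakk>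
      \<Longrightarrow> fmor F (cmp C g f) a = fmor F g (fmor F f a)"

text \<open>
  The morphism \<open>(f, a)\<close> of the Grothendieck construction is \<open>f\<close> regarded as a morphism from
  \<open>(src C f, a)\<close> to \<open>(tgt C f, fmor F f a)\<close>.
\<close>

definition grothendieck :: "('o, 'm, 'z) cat_scheme \<Rightarrow> ('o, 'm, 'g, 'a, 'w) gset_functor_scheme
    \<Rightarrow> ('o \<times> 'a, 'm \<times> 'a, 'g) gcat" where
  "grothendieck C F = (let
     obs = (SIGMA x : obj C. fobj F x);
     mors = (SIGMA f : mor C. fobj F (src C f))
   in
    \<lparr>obj = obs,
     mor = mors,
     src = (\<lambda>(f, a). (src C f, a)),
     tgt = (\<lambda>(f, a). (tgt C f, fmor F f a)),
     idt = (\<lambda>(x, a). (idt C x, a)),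
     cmp = (\<lambda>(g, b) (f, a). (cmp C g f, a)),
     obj_act = (\<lambda>g. \<lambda>(x, a) \<in> obs. (x, fobj_act F x g a)),
     mor_act = (\<lambda>g. \<lambda>(f, a) \<in> mors. (f, fobj_act F (src C f) g a))\<rparr>)"


lemma group_actionI:
  assumes "group G"
    and closed: "\<And>g x. \<lbrakk>g \<in> carrier G; x \<in> E\<rbrakk> \<Longrightarrow> \<phi> g x \<in> E"
    and ext: "\<And>g. g \<in> carrier G \<Longrightarrow> \<phi> g \<in> extensional E"
    and one: "\<And>x. x \<in> E \<Longrightarrow> \<phi> \<one>\<^bsub>G\<^esub> x = x"
    and mult: "\<And>g h x. \<lbrakk>g \<in> carrier G; h \<in> carrier G; x \<in> E\<rbrakk> \<Longrightarrow> \<phi> (g \<otimes>\<^bsub>G\<^esub> h) x = \<phi> g (\<phi> h x)"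
  shows "group_action G E \<phi>"
proof -
  interpret G: group G by fact
  have bij: "bij_betw (\<phi> g) E E" if g: "g \<in> carrier G" for g
  proof (rule bij_betw_byWitness[where f' = "\<phi> (inv\<^bsub>G\<^esub> g)"])
    have *: "inv\<^bsub>G\<^esub> g \<in> carrier G" using g by simp
    show "\<forall>a\<in>E. \<phi> (inv\<^bsub>G\<^esub> g) (\<phi> g a) = a"
      using mult[OF * g] one g by (metis G.l_inv)
    show "\<forall>a\<in>E. \<phi> g (\<phi> (inv\<^bsub>G\<^esub> g) a) = a"
      using mult[OF g *] one g by (metis G.r_inv)
  qed (use g closed in auto)
  have "\<phi> \<in> hom G (BijGroup E)"
  proof (rule homI)
    fix g assume "g \<in> carrier G"
    then show "\<phi> g \<in> carrier (BijGroup E)"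
      using bij ext by (auto simp: BijGroup_def Bij_def)
  next
    fix g h assume gh: "g \<in> carrier G" "h \<in> carrier G"
    have "\<phi> (g \<otimes>\<^bsub>G\<^esub> h) = compose E (\<phi> g) (\<phi> h)"
      using gh ext[of "g \<otimes>\<^bsub>G\<^esub> h"] mult
      by (intro extensionalityI[of _ E]) (auto simp: compose_def)
    then show "\<phi> (g \<otimes>\<^bsub>G\<^esub> h) = \<phi> g \<otimes>\<^bsub>BijGroup E\<^esub> \<phi> h"
      using gh bij ext by (auto simp: BijGroup_def Bij_def)
  qed
  then show ?thesis
    by (intro group_action.intro group_hom.intro group_hom_axioms.intro group_BijGroup \<open>group G\<close>)
qed

lemma group_actionD:
  assumes "group_action G E \<phi>"
  shows "group G"
    and "\<And>g x. \<lbrakk>g \<in> carrier G; x \<in> E\<rbrakk> \<Longrightarrow> \<phi> g x \<in> E"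
    and "\<And>x. x \<in> E \<Longrightarrow> \<phi> \<one>\<^bsub>G\<^esub> x = x"
    and "\<And>g h x. \<lbrakk>g \<in> carrier G; h \<in> carrier G; x \<in> E\<rbrakk> \<Longrightarrow> \<phi> (g \<otimes>\<^bsub>G\<^esub> h) x = \<phi> g (\<phi> h x)"
proof -
  interpret A: group_action G E \<phi> by fact
  show "group G" using A.group_hom group_hom_def by blast
  show "\<And>g x. \<lbrakk>g \<in> carrier G; x \<in> E\<rbrakk> \<Longrightarrow> \<phi> g x \<in> E" using A.element_image by blast
  show "\<And>x. x \<in> E \<Longrightarrow> \<phi> \<one>\<^bsub>G\<^esub> x = x" by (metis A.id_eq_one restrict_apply')
  show "\<And>g h x. \<lbrakk>g \<in> carrier G; h \<in> carrier G; x \<in> E\<rbrakk> \<Longrightarrow> \<phi> (g \<otimes>\<^bsub>G\<^esub> h) x = \<phi> g (\<phi> h x)"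
    using A.composition_rule by blast
qed

lemma gcategory_grothendieck:
  fixes G :: "('g, 'y) monoid_scheme" (structure)
  assumes "functor_to_finite_gsets G C F"
  shows "gcategory G (grothendieck C F)"
proof -
  interpret functor_to_finite_gsets G C F by fact
  have act: "group_action G (fobj F x) (fobj_act F x)" if "x \<in> obj C" for x
    using fobj_gset[OF that] by (simp add: finite_gset_def)
  note gD = group_actionD(2-4)[OF act]
  have fm: "fmor F f a \<in> fobj F (tgt C f)" if "f \<in> mor C" "a \<in> fobj F (src C f)" for f a
    using fmor_equivariant[OF that(1)] that(2) by (auto simp: equivariant_def)
  have fe: "fmor F f (fobj_act F (src C f) g a) = fobj_act F (tgt C f) g (fmor F f a)"
    if "f \<in> mor C" "a \<in> fobj F (src C f)" "g \<in> carrier G" for f a g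
    using fmor_equivariant[OF that(1)] that(2,3) by (auto simp: equivariant_def)
  note s = grothendieck_def Let_def
  show ?thesis
  proof (intro gcategory.intro gcategory_axioms.intro category.intro)
    show "Group.group G" by (rule is_group)
    show "group_action G (obj (grothendieck C F)) (obj_act (grothendieck C F))"
      by (rule group_actionI) (auto simp: s is_group gD)
    show "group_action G (mor (grothendieck C F)) (mor_act (grothendieck C F))"
      by (rule group_actionI) (auto simp: s is_group gD src_obj)
  qed ((simp only: s cat.simps gcat.simps; clarsimp); simp add: s src_obj tgt_obj idt_mor src_idt tgt_idt cmp_mor src_cmp tgt_cmp cmp_idt_left
      cmp_idt_right cmp_assoc fm fe gD fmor_idt fmor_cmp)+
qed


section \<open>The series Lefschetz invariant\<close>

text \<open>
  A chain of \<open>n\<close> composable non-identity morphisms is recorded together with its initial object,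
  which is redundant for \<open>n > 0\<close> and makes the chains of length \<open>0\<close> the objects.
\<close>

fun is_chain :: "('o, 'm, 'z) cat_scheme \<Rightarrow> 'o \<Rightarrow> 'm list \<Rightarrow> bool" where
  "is_chain D x [] \<longleftrightarrow> x \<in> obj D"
| "is_chain D x (f # fs) \<longleftrightarrow>
     f \<in> mor D \<and> f \<notin> idt D ` obj D \<and> src D f = x \<and> is_chain D (tgt D f) fs"

definition chains :: "('o, 'm, 'z) cat_scheme \<Rightarrow> nat \<Rightarrow> ('o \<times> 'm list) set" where
  "chains D n = {(x, fs). length fs = n \<and> is_chain D x fs}"

definition chain_act ::
    "('o, 'm, 'g, 'z) gcat_scheme \<Rightarrow> nat \<Rightarrow> 'g \<Rightarrow> 'o \<times> 'm list \<Rightarrow> 'o \<times> 'm list" where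
  "chain_act D n g = (\<lambda>(x, fs) \<in> chains D n. (obj_act D g x, map (mor_act D g) fs))"

definition lefschetz_series ::
    "('g, 'y) monoid_scheme \<Rightarrow> ('o, 'm, 'g, 'z) gcat_scheme \<Rightarrow> nat \<Rightarrow> 'g burnside" where
  "lefschetz_series G D n = burnside_class G (chains D n) (chain_act D n)"

definition fls_of_ratfun :: "rat poly \<Rightarrow> rat poly \<Rightarrow> rat fls" where
  "fls_of_ratfun p q = fps_to_fls (fps_of_poly p) / fps_to_fls (fps_of_poly q)"

text \<open>
  The power series \<open>f\<close> with coefficients in \<open>\<Omega>(G)\<close> coincides, coefficient by coefficient as a
  Laurent series, with the element \<open>\<Sum>i. \<omega>\<^sub>i \<otimes> (p\<^sub>i / q\<^sub>i)\<close> of the tensor product of \<open>\<Omega>(G)\<close> with the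
  localisation of \<open>\<rat>[t]\<close> at \<open>(t + 1)\<close>, whose value at \<open>t = -1\<close> is \<open>v\<close>.
\<close>

definition value_at_minus_one ::
    "('g, 'y) monoid_scheme \<Rightarrow> (nat \<Rightarrow> 'g burnside) \<Rightarrow> 'g burnside \<Rightarrow> bool" where
  "value_at_minus_one G f v \<longleftrightarrow>
    (\<exists>(m :: nat) \<omega> p q.
      (\<forall>i < m. \<omega> i \<in> carrier (burnside_ring G) \<and> \<not> [:1, 1:] dvd q i) \<and>
      (\<forall>n :: int. (if n < 0 then \<zero>\<^bsub>burnside_ring G\<^esub> else f (nat n)) =
         (\<Oplus>\<^bsub>burnside_ring G\<^esub>i \<in> {..<m}. fls_nth (fls_of_ratfun (p i) (q i)) n \<odot>\<^bsub>burnside_ring G\<^esub> \<omega> i)) \<and>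
      v = (\<Oplus>\<^bsub>burnside_ring G\<^esub>i \<in> {..<m}. (poly (p i) (-1) / poly (q i) (-1)) \<odot>\<^bsub>burnside_ring G\<^esub> \<omega> i))"

definition has_series_Lefschetz_invariant ::
    "('g, 'y) monoid_scheme \<Rightarrow> ('o, 'm, 'g, 'z) gcat_scheme \<Rightarrow> bool" where
  "has_series_Lefschetz_invariant G D \<longleftrightarrow> (\<exists>v. value_at_minus_one G (lefschetz_series G D) v)"

definition series_Lefschetz_invariant ::
    "('g, 'y) monoid_scheme \<Rightarrow> ('o, 'm, 'g, 'z) gcat_scheme \<Rightarrow> 'g burnside" where
  "series_Lefschetz_invariant G D = (THE v. value_at_minus_one G (lefschetz_series G D) v)"

end

theory Submission
  imports Defs
begin

text \<open>
  A chain in \<open>\<integral>F\<close> is a chain of \<open>C\<close> starting at some \<open>x\<close> together with a point of \<open>F x\<close>, so its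
  series is \<open>\<Sum>x. u\<^sub>x(t) [F x]\<close>, where \<open>u\<^sub>x(t) = \<Sum>n. c\<^sub>n(x) t\<^sup>n\<close> counts the chains of \<open>C\<close> starting at \<open>x\<close>. The
  counts satisfy \<open>c\<^sub>n\<^sub>+\<^sub>1 = \<zeta> c\<^sub>n - c\<^sub>n\<close> and are constant on isomorphism classes, where \<open>\<zeta>\<close> is injective.
  Hence a polynomial \<open>P\<close> of least degree with \<open>\<Sum>j. P\<^sub>j c\<^sub>j = 0\<close> has \<open>P(-1) \<noteq> 0\<close>, and \<open>u\<^sub>x\<close> is rational with
  denominator the reflection of \<open>P\<close>. Evaluating \<open>(1 + t) u - t \<zeta> u = 1\<close> at \<open>t = -1\<close> shows that \<open>u(-1)\<close> is the
  skeletal weighting.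
\<close>

section \<open>Chains and the zeta operator\<close>

lemma (in category) iso_objs_refl: "x \<in> obj C \<Longrightarrow> iso_objs C x x"
  using idt_mor[of x] src_idt[of x] tgt_idt[of x] cmp_idt_left[of "idt C x"]
  by (auto simp: iso_objs_def homset_def)

text \<open>Precomposition with one direction of an isomorphism is a bijection of hom-sets, undone
  by precomposition with the other. So rows of \<open>zeta C\<close> at isomorphic objects
  agree.\<close>

lemma (in category) card_homset_iso:
  assumes "iso_objs C x x'" "y \<in> obj C"
  shows "card (homset C x y) = card (homset C x' y)"
proof -
  obtain f g where f: "f \<in> homset C x x'" and g: "g \<in> homset C x' x"
    and gf: "cmp C g f = idt C x" and fg: "cmp C f g = idt C x'"
    using assms(1) unfolding iso_objs_def by blast
  have "bij_betw (\<lambda>h. cmp C h g) (homset C x y) (homset C x' y)"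
  proof (rule bij_betw_byWitness[where f' = "\<lambda>h. cmp C h f"])
    show "\<forall>h\<in>homset C x y. cmp C (cmp C h g) f = h"
      using f g gf cmp_idt_right by (fastforce simp: homset_def cmp_assoc[symmetric])
    show "\<forall>h\<in>homset C x' y. cmp C (cmp C h f) g = h"
      using f g fg cmp_idt_right by (fastforce simp: homset_def cmp_assoc[symmetric])
  qed (use f g in \<open>auto simp: homset_def cmp_mor src_cmp tgt_cmp\<close>)
  then show ?thesis by (rule bij_betw_same_card)
qed

text \<open>The matrix \<open>zeta C\<close> applied to a column vector. Vectors are plain
  functions, so that chain counts and polynomial values can be inserted without
  \<open>restrict\<close>.\<close>

definition zeta_op :: "('o, 'm, 'z) cat_scheme \<Rightarrow> ('o \<Rightarrow> rat) \<Rightarrow> 'o \<Rightarrow> rat" where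
  "zeta_op C v x = (\<Sum>y\<in>obj C. of_nat (card (homset C x y)) * v y)"

definition iso_invariant :: "('o, 'm, 'z) cat_scheme \<Rightarrow> ('o \<Rightarrow> rat) \<Rightarrow> bool" where
  "iso_invariant C v \<longleftrightarrow> (\<forall>x y. iso_objs C x y \<longrightarrow> v x = v y)"

lemma iso_invariantD: "iso_invariant C v \<Longrightarrow> iso_objs C x y \<Longrightarrow> v x = v y"
  by (simp add: iso_invariant_def)

lemma zeta_op_sum:
  "zeta_op C (\<lambda>y. \<Sum>j\<in>J. a j * v j y) x = (\<Sum>j\<in>J. a j * zeta_op C (v j) x)"
  unfolding zeta_op_def sum_distrib_left by (subst sum.swap) (simp add: mult_ac)

lemma (in category) iso_invariant_zeta_op: "iso_invariant C (zeta_op C v)"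
  unfolding iso_invariant_def zeta_op_def
  using card_homset_iso by (auto intro!: sum.cong)

lemma (in finite_category) iso_class_props:
  assumes "x \<in> obj C"
  shows "iso_class C x \<subseteq> obj C" "finite (iso_class C x)" "card (iso_class C x) \<noteq> 0"
proof -
  show "iso_class C x \<subseteq> obj C" by (auto simp: iso_class_def iso_objs_def)
  then show "finite (iso_class C x)" using finite_obj finite_subset by blast
  moreover have "x \<in> iso_class C x" using iso_objs_refl[OF assms] by (simp add: iso_class_def)
  ultimately show "card (iso_class C x) \<noteq> 0" by auto
qed

text \<open>If \<open>\<eta>\<close> is a left inverse of \<open>zeta C\<close> in the corner
  algebra, then \<open>e v = \<eta> (\<zeta> v) = 0\<close>, and the idempotent \<open>e\<close>,
  which averages over isomorphism classes, fixes every invariant \<open>v\<close>. Invariance is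
  essential: with distinct isomorphic objects \<open>zeta C\<close> has equal rows and is
  singular.\<close>

lemma (in finite_category) zeta_op_injective:
  assumes "has_skeletal_Moebius_inversion C" and v: "iso_invariant C v"
    and zero: "\<And>x. x \<in> obj C \<Longrightarrow> zeta_op C v x = 0" and x: "x \<in> obj C"
  shows "v x = 0"
proof -
  obtain \<eta> where "\<eta> \<otimes>\<^bsub>matrix_algebra C\<^esub> zeta C = iso_idempotent C"
    using assms(1) unfolding has_skeletal_Moebius_inversion_def Units_def
    by (auto simp: corner_algebra_def)
  then have e: "(\<Sum>z\<in>obj C. \<eta> (x, z) * of_nat (card (homset C z y))) = iso_idempotent C (x, y)"
    if "y \<in> obj C" for y
    using x that by (auto simp: matrix_algebra_def zeta_def dest!: fun_cong[where x = "(x, y)"])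
  have "0 = (\<Sum>z\<in>obj C. \<eta> (x, z) * zeta_op C v z)" using zero by simp
  also have "\<dots> = (\<Sum>y\<in>obj C. iso_idempotent C (x, y) * v y)"
    unfolding zeta_op_def sum_distrib_left
    by (subst sum.swap) (simp add: e[symmetric] sum_distrib_right mult.assoc)
  \<comment> \<open>Row \<open>x\<close> of the idempotent is supported on the class of
    \<open>x\<close>, where \<open>v\<close> has the constant value \<open>v x\<close>.\<close>
  also have "\<dots> = (\<Sum>y\<in>iso_class C x. v x / of_nat (card (iso_class C x)))"
    using iso_class_props[OF x] finite_obj x iso_invariantD[OF v, of x]
    by (intro sum.mono_neutral_cong_right) (auto simp: iso_idempotent_def iso_class_def)
  also have "\<dots> = v x" using iso_class_props[OF x] by simp
  finally show ?thesis by simp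
qed

section \<open>Counting chains by their starting object\<close>

definition chains_from :: "('o, 'm, 'z) cat_scheme \<Rightarrow> nat \<Rightarrow> 'o \<Rightarrow> 'm list set" where
  "chains_from C n x = {fs. length fs = n \<and> is_chain C x fs}"

definition num_chains :: "('o, 'm, 'z) cat_scheme \<Rightarrow> nat \<Rightarrow> 'o \<Rightarrow> rat" where
  "num_chains C n x = of_nat (card (chains_from C n x))"

lemma chains_from_0: "chains_from C 0 x = (if x \<in> obj C then {[]} else {})"
  by (auto simp: chains_from_def)

lemma chains_from_Suc:
  "chains_from C (Suc n) x =
    (\<Union>f\<in>{f \<in> mor C. src C f = x} - idt C ` obj C. (#) f ` chains_from C n (tgt C f))"
  by (auto simp: chains_from_def length_Suc_conv image_iff)

lemma (in finite_category) finite_chains_from: "finite (chains_from C n x)"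
  by (induction n arbitrary: x) (use finite_mor in \<open>auto simp: chains_from_0 chains_from_Suc\<close>)

lemma is_chain_obj: "category D \<Longrightarrow> is_chain D x fs \<Longrightarrow> x \<in> obj D"
  by (cases fs) (auto dest: category.src_obj)

lemma chains_conv_Sigma: "category C \<Longrightarrow> chains C n = Sigma (obj C) (chains_from C n)"
  by (auto simp: chains_def chains_from_def dest: is_chain_obj)

lemma (in finite_category) num_chains_0: "x \<in> obj C \<Longrightarrow> num_chains C 0 x = 1"
  by (simp add: num_chains_def chains_from_0)

text \<open>Sort chains by their first morphism. Admitting all morphisms out of \<open>x\<close>
  gives \<open>\<zeta>\<close> applied to the counts of length \<open>n\<close>; the excess comes
  from a first morphism that is an identity.\<close>

lemma (in finite_category) num_chains_Suc:
  assumes x: "x \<in> obj C"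
  shows "num_chains C (Suc n) x = zeta_op C (num_chains C n) x - num_chains C n x"
proof -
  let ?M = "{f \<in> mor C. src C f = x}"
  have M: "finite ?M" using finite_mor by simp
  \<comment> \<open>Exactly one identity starts at \<open>x\<close>, so exactly one term is
    subtracted.\<close>
  have id: "?M \<inter> idt C ` obj C = {idt C x}"
    using x idt_mor src_idt by auto
  have "num_chains C (Suc n) x = (\<Sum>f\<in>?M - idt C ` obj C. num_chains C n (tgt C f))"
    unfolding num_chains_def chains_from_Suc
    using M finite_chains_from by (subst card_UN_disjoint) (auto simp: card_image)
  also have "\<dots> = (\<Sum>f\<in>?M. num_chains C n (tgt C f)) - num_chains C n x"
    using sum.Int_Diff[OF M, of "\<lambda>f. num_chains C n (tgt C f)" "idt C ` obj C"] id x tgt_idt by simp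
  also have "(\<Sum>f\<in>?M. num_chains C n (tgt C f)) =
      (\<Sum>y\<in>obj C. \<Sum>f\<in>{f \<in> ?M. tgt C f = y}. num_chains C n (tgt C f))"
    using M finite_obj tgt_obj by (intro sum.group[symmetric]) auto
  also have "\<dots> = zeta_op C (num_chains C n) x"
    unfolding zeta_op_def
    by (intro sum.cong refl) (auto simp: homset_def intro!: arg_cong[where f = card])
  finally show ?thesis .
qed

text \<open>Precomposing the first morphism of a chain with an isomorphism may produce an identity,
  so the bijection of hom-sets does not carry over to chains. The recurrence
  \<open>num_chains_Suc\<close> gives invariance instead, because the image of
  \<open>zeta_op\<close> is invariant.\<close>

lemma (in finite_category) iso_invariant_num_chains: "iso_invariant C (num_chains C n)"
proof (induction n)
  case 0
  show ?case by (auto simp: iso_invariant_def iso_objs_def num_chains_0)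
next
  case (Suc n)
  have "num_chains C (Suc n) x = num_chains C (Suc n) y" if xy: "iso_objs C x y" for x y
  proof -
    have "x \<in> obj C" "y \<in> obj C" using xy by (auto simp: iso_objs_def)
    then show ?thesis
      using iso_invariantD[OF Suc xy] iso_invariantD[OF iso_invariant_zeta_op xy]
      by (simp add: num_chains_Suc)
  qed
  then show ?case by (simp add: iso_invariant_def)
qed


section \<open>The generating functions of chains\<close>

text \<open>Finitely many linear functionals on polynomials have common zeros of arbitrarily large
  degree. For a new functional, combine two common zeros of the old ones so that its values cancel;
  if their degrees differ, the larger degree survives. The free bound \<open>N\<close> supplies the
  two degrees.\<close>

lemma exists_poly_annihilated:
  fixes L :: "'x \<Rightarrow> 'k::field poly \<Rightarrow> 'k"
  assumes "finite X"
    and lin: "\<And>x a P Q. L x (P - smult a Q) = L x P - a * L x Q"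
  shows "\<exists>P. degree P > N \<and> (\<forall>x\<in>X. L x P = 0)"
  using assms(1)
proof (induction X arbitrary: N rule: finite_induct)
  case empty
  show ?case by (rule exI[of _ "monom 1 (Suc N)"]) (simp add: degree_monom_eq)
next
  case (insert x X)
  from insert.IH[of N] obtain Q where Q: "degree Q > N" "\<forall>y\<in>X. L y Q = 0" by blast
  show ?case
  proof (cases "L x Q = 0")
    case True
    with Q show ?thesis by auto
  next
    case False
    from insert.IH[of "degree Q"] obtain P where P: "degree P > degree Q" "\<forall>y\<in>X. L y P = 0"
      by blast
    let ?R = "P - smult (L x P / L x Q) Q"
    have "degree ?R = degree P"
      using P(1) degree_smult_le[of "L x P / L x Q" Q]
      by (simp add: diff_conv_add_uminus degree_add_eq_left del: add_uminus_conv_diff)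
    then show ?thesis using P Q False by (intro exI[of _ ?R]) (auto simp: lin)
  qed
qed

text \<open>The linear functional on polynomials that sends \<open>X^j\<close> to
  \<open>c j\<close>. A linear recurrence with characteristic polynomial \<open>P\<close> says that
  it kills \<open>P\<close> for every shift of \<open>c\<close>.\<close>

definition poly_sum :: "(nat \<Rightarrow> 'k) \<Rightarrow> 'k::field poly \<Rightarrow> 'k" where
  "poly_sum c P = (\<Sum>j\<le>degree P. coeff P j * c j)"

lemma poly_sum_eq: "degree P \<le> N \<Longrightarrow> poly_sum c P = (\<Sum>j\<le>N. coeff P j * c j)"
  unfolding poly_sum_def by (rule sum.mono_neutral_left) (auto simp: coeff_eq_0)

lemma poly_sum_diff_smult: "poly_sum c (P - smult a Q) = poly_sum c P - a * poly_sum c Q"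
proof -
  let ?N = "max (degree P) (degree Q)"
  have "degree (P - smult a Q) \<le> ?N"
    by (rule degree_diff_le) (auto intro: order.trans[OF degree_smult_le])
  then show ?thesis
    by (simp add: poly_sum_eq[of _ ?N] algebra_simps sum_subtractf sum_distrib_left)
qed

text \<open>Multiplication by \<open>X\<close> shifts the sequence. For chain counts the sum of two
  neighbours is \<open>\<zeta>\<close> applied to the first, so the factor \<open>1 + X\<close>
  becomes \<open>zeta_op\<close>.\<close>

lemma poly_sum_one_plus_X:
  "poly_sum c ([:1, 1:] * R) = poly_sum (\<lambda>j. c j + c (Suc j)) R"
proof -
  let ?d = "degree R"
  have deg: "degree ([:1, 1:] * R) \<le> Suc ?d"
    using degree_mult_le[of "[:1, 1:]" R] by simp
  have *: "coeff ([:1, 1:] * R) j = coeff R j + (case j of 0 \<Rightarrow> 0 | Suc i \<Rightarrow> coeff R i)" for j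
    by (simp add: coeff_pCons split: nat.split)
  show ?thesis
    unfolding poly_sum_eq[OF deg] * distrib_right sum.distrib
    by (subst (2) sum.atMost_Suc_shift)
      (simp add: poly_sum_def coeff_eq_0 algebra_simps sum.distrib)
qed

lemma (in finite_category) poly_sum_Suc:
  assumes "x \<in> obj C"
  shows "poly_sum (\<lambda>j. num_chains C (m + j) x + num_chains C (Suc (m + j)) x) P =
    zeta_op C (\<lambda>y. poly_sum (\<lambda>j. num_chains C (m + j) y) P) x"
  by (simp add: poly_sum_def zeta_op_sum num_chains_Suc[OF assms])

lemma (in finite_category) iso_invariant_poly_sum:
  "iso_invariant C (\<lambda>y. poly_sum (\<lambda>j. num_chains C j y) P)"
  using iso_invariant_num_chains by (simp add: iso_invariant_def poly_sum_def)

text \<open>A polynomial of minimal degree annihilating the sequence of chain counts cannot vanish at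
  \<open>-1\<close>: a factor \<open>X + 1\<close> acts as the zeta operator, which is injective.\<close>

lemma (in finite_category) exists_recurrence:
  assumes "has_skeletal_Moebius_inversion C"
  obtains P where "poly P (-1) \<noteq> 0"
    "\<And>x m. x \<in> obj C \<Longrightarrow> poly_sum (\<lambda>j. num_chains C (m + j) x) P = 0"
proof -
  define ann where "ann P \<longleftrightarrow> P \<noteq> 0 \<and> (\<forall>x\<in>obj C. poly_sum (\<lambda>j. num_chains C j x) P = 0)" for P
  obtain P\<^sub>0 where "degree P\<^sub>0 > 0" "\<forall>x\<in>obj C. poly_sum (\<lambda>j. num_chains C j x) P\<^sub>0 = 0"
    using exists_poly_annihilated[OF finite_obj, of "\<lambda>x. poly_sum (\<lambda>j. num_chains C j x)" 0]
    by (auto simp: poly_sum_diff_smult)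
  then have "ann P\<^sub>0" by (auto simp: ann_def)
  then obtain P where P: "ann P" and least: "\<And>Q. ann Q \<Longrightarrow> degree P \<le> degree Q"
    using ex_has_least_nat[of ann P\<^sub>0 degree] by blast
  have "poly P (-1) \<noteq> 0"
  proof
    assume "poly P (-1) = 0"
    then have "[:1, 1:] dvd P" by (simp add: poly_eq_0_iff_dvd)
    then obtain R where R: "P = [:1, 1:] * R" by (rule dvdE)
    with P have "R \<noteq> 0" by (auto simp: ann_def)
    then have deg: "degree R < degree P" unfolding R by (subst degree_mult_eq) auto
    have "zeta_op C (\<lambda>y. poly_sum (\<lambda>j. num_chains C j y) R) x = 0" if "x \<in> obj C" for x
    proof -
      have "poly_sum (\<lambda>j. num_chains C j x) ([:1, 1:] * R) = 0"
        using P that unfolding ann_def R by blast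
      then show ?thesis using poly_sum_Suc[OF that, of 0 R] by (simp only: poly_sum_one_plus_X add_0)
    qed
    then have "ann R"
      using zeta_op_injective[OF assms iso_invariant_poly_sum] \<open>R \<noteq> 0\<close> unfolding ann_def by blast
    then show False using least[of R] deg by simp
  qed
  moreover have "poly_sum (\<lambda>j. num_chains C (m + j) x) P = 0" if "x \<in> obj C" for x m
    using that
  proof (induction m arbitrary: x)
    case 0
    then show ?case using P by (simp add: ann_def)
  next
    case (Suc m)
    \<comment> \<open>The values at shifts \<open>m\<close> and \<open>m + 1\<close> add up to
      \<open>\<zeta>\<close> of the vector of values at shift \<open>m\<close>. That vector vanishes
      at all objects by induction, which leaves zero at shift \<open>m + 1\<close>.\<close>
    have "poly_sum (\<lambda>j. num_chains C (m + j) x) P + poly_sum (\<lambda>j. num_chains C (Suc m + j) x) P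
      = zeta_op C (\<lambda>y. poly_sum (\<lambda>j. num_chains C (m + j) y) P) x"
      using poly_sum_Suc[OF Suc.prems, of m P]
      by (simp add: poly_sum_def algebra_simps sum.distrib)
    also have "\<dots> = 0" using Suc.IH by (simp add: zeta_op_def)
    finally show ?case using Suc by simp
  qed
  ultimately show ?thesis by (rule that)
qed

text \<open>Reflection reverses the coefficients, so from degree \<open>degree P\<close> on, the
  coefficients of the product are instances of the recurrence and vanish.\<close>

lemma fps_mult_poly_recurrence:
  fixes u :: "'k::field fps"
  assumes "\<And>m. poly_sum (\<lambda>j. fps_nth u (m + j)) P = 0"
  obtains p where "fps_of_poly p = fps_of_poly (reflect_poly P) * u"
proof
  let ?d = "degree P"
  let ?w = "fps_of_poly (reflect_poly P) * u"
  have vanish: "fps_nth ?w n = 0" if n: "?d \<le> n" for n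
  proof -
    have "fps_nth ?w n = (\<Sum>i\<le>n. coeff (reflect_poly P) i * fps_nth u (n - i))"
      by (simp add: fps_mult_nth atLeast0AtMost)
    also have "\<dots> = (\<Sum>i\<le>?d. coeff P (?d - i) * fps_nth u (n - i))"
      using n by (intro sum.mono_neutral_cong_right) (auto simp: coeff_reflect_poly)
    also have "\<dots> = (\<Sum>j\<le>?d. coeff P j * fps_nth u ((n - ?d) + j))"
      using n by (intro sum.reindex_bij_witness[of _ "\<lambda>j. ?d - j" "\<lambda>j. ?d - j"]) auto
    also have "\<dots> = 0" using assms[of "n - ?d"] by (simp add: poly_sum_def)
    finally show ?thesis .
  qed
  \<comment> \<open>The numerator is the product cut off below \<open>degree P\<close>.\<close>
  show "fps_of_poly (Poly (map (fps_nth ?w) [0..<?d])) = ?w"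
    using vanish by (intro fps_ext) (auto simp: nth_default_def)
qed

text \<open>A single denominator \<open>q\<close> serves all objects, because the recurrence
  does.\<close>

lemma (in finite_category) chain_series_rational:
  assumes "has_skeletal_Moebius_inversion C"
  obtains p q where "poly q (-1) \<noteq> 0"
    "\<And>x. x \<in> obj C \<Longrightarrow> fps_of_poly (p x) = fps_of_poly q * Abs_fps (\<lambda>n. num_chains C n x)"
proof -
  obtain P where P: "poly P (-1) \<noteq> 0"
      "\<And>x m. x \<in> obj C \<Longrightarrow> poly_sum (\<lambda>j. num_chains C (m + j) x) P = 0"
    using exists_recurrence[OF assms] by blast
  have "\<exists>p. fps_of_poly p = fps_of_poly (reflect_poly P) * Abs_fps (\<lambda>n. num_chains C n x)"
    if "x \<in> obj C" for x
    by (rule fps_mult_poly_recurrence[of "Abs_fps (\<lambda>n. num_chains C n x)" P])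
      (use P that in auto)
  then obtain p where
    "\<And>x. x \<in> obj C \<Longrightarrow>
      fps_of_poly (p x) = fps_of_poly (reflect_poly P) * Abs_fps (\<lambda>n. num_chains C n x)"
    by metis
  \<comment> \<open>As \<open>-1\<close> is its own inverse, reflection changes the value there at
    most by a sign.\<close>
  moreover have "poly (reflect_poly P) (-1) \<noteq> 0"
    using P by (simp add: poly_reflect_poly_nz)
  ultimately show ?thesis using that by blast
qed

text \<open>Evaluates the identity \<open>(1 + t) u - t \<zeta> u = 1\<close>, multiplied by the denominator, at \<open>t = -1\<close>.\<close>

lemma (in finite_category) zeta_op_numerators:
  assumes u: "\<And>x. x \<in> obj C \<Longrightarrow> fps_of_poly (p x) = fps_of_poly q * Abs_fps (\<lambda>n. num_chains C n x)"
    and x: "x \<in> obj C"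
  shows "zeta_op C (\<lambda>y. poly (p y) (-1)) x = poly q (-1)"
proof -
  let ?u = "\<lambda>x. Abs_fps (\<lambda>n. num_chains C n x)"
  let ?h = "\<lambda>y. of_nat (card (homset C x y)) :: rat"
  \<comment> \<open>The recurrence \<open>num_chains_Suc\<close> and the initial value
    \<open>1\<close>, read as one identity of power series.\<close>
  have "(1 + fps_X) * ?u x = 1 + fps_X * (\<Sum>y\<in>obj C. fps_const (?h y) * ?u y)"
  proof (rule fps_ext)
    fix n
    show "fps_nth ((1 + fps_X) * ?u x) n =
        fps_nth (1 + fps_X * (\<Sum>y\<in>obj C. fps_const (?h y) * ?u y)) n"
      by (cases n)
        (simp_all add: distrib_right num_chains_0[OF x] num_chains_Suc[OF x] fps_sum_nth zeta_op_def)
  qed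
  then have "fps_of_poly q * ((1 + fps_X) * ?u x) =
      fps_of_poly q * (1 + fps_X * (\<Sum>y\<in>obj C. fps_const (?h y) * ?u y))" by simp
  then have "(1 + fps_X) * fps_of_poly (p x) =
      fps_of_poly q + fps_X * (\<Sum>y\<in>obj C. fps_const (?h y) * fps_of_poly (p y))"
    by (simp add: u x sum_distrib_left algebra_simps)
  then have "fps_of_poly ([:1, 1:] * p x) =
      fps_of_poly (q + [:0, 1:] * (\<Sum>y\<in>obj C. smult (?h y) (p y)))"
    by (simp add: fps_of_poly_mult fps_of_poly_add fps_of_poly_sum fps_of_poly_smult fps_of_poly_pCons
        algebra_simps del: mult_pCons_left)
  then have "[:1, 1:] * p x = q + [:0, 1:] * (\<Sum>y\<in>obj C. smult (?h y) (p y))"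
    by (simp only: fps_of_poly_eq_iff)
  \<comment> \<open>At \<open>-1\<close> the left side vanishes and \<open>t\<close> becomes
    \<open>-1\<close>, so \<open>q(-1)\<close> equals the \<open>\<zeta>\<close>-image of the
    numerators' values.\<close>
  then have "poly ([:1, 1:] * p x) (-1) =
      poly (q + [:0, 1:] * (\<Sum>y\<in>obj C. smult (?h y) (p y))) (-1)" by simp
  then show ?thesis by (simp add: zeta_op_def poly_sum)
qed

text \<open>The difference of two invariant solutions is an invariant vector killed by
  \<open>\<zeta>\<close>, hence zero on objects. Weightings are extensional, so the candidate
  selected by \<open>THE\<close> is the restriction of \<open>w\<close>.\<close>

lemma (in finite_category) skeletal_weighting_eqI:
  assumes "has_skeletal_Moebius_inversion C" and w: "iso_invariant C w"
    and one: "\<And>x. x \<in> obj C \<Longrightarrow> zeta_op C w x = 1" and "x \<in> obj C"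
  shows "skeletal_weighting C x = w x"
proof -
  have "is_skeletal_weighting C (restrict w (obj C))"
    using w one by (auto simp: is_skeletal_weighting_def iso_invariant_def iso_objs_def zeta_op_def)
  moreover have "k = restrict w (obj C)" if k: "is_skeletal_weighting C k" for k
  proof
    fix y
    have "iso_invariant C (\<lambda>y. k y - w y)"
      using k w by (auto simp: is_skeletal_weighting_def iso_invariant_def)
    moreover have "zeta_op C (\<lambda>y. k y - w y) z = 0" if "z \<in> obj C" for z
      using k one that unfolding zeta_op_def is_skeletal_weighting_def
      by (simp add: right_diff_distrib sum_subtractf)
    ultimately have "y \<in> obj C \<Longrightarrow> k y - w y = 0"
      by (rule zeta_op_injective[OF assms(1)])
    then show "k y = restrict w (obj C) y"
      using k by (auto simp: is_skeletal_weighting_def PiE_def extensional_def)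
  qed
  ultimately have "skeletal_weighting C = restrict w (obj C)"
    unfolding skeletal_weighting_def by blast
  then show ?thesis using assms(4) by simp
qed

lemma (in finite_category) skeletal_weighting_eq_value:
  assumes "has_skeletal_Moebius_inversion C" and q: "poly q (-1) \<noteq> 0"
    and u: "\<And>x. x \<in> obj C \<Longrightarrow> fps_of_poly (p x) = fps_of_poly q * Abs_fps (\<lambda>n. num_chains C n x)"
    and x: "x \<in> obj C"
  shows "skeletal_weighting C x = poly (p x) (-1) / poly q (-1)"
proof (rule skeletal_weighting_eqI[OF assms(1) _ _ x])
  have "p y = p z" if "iso_objs C y z" for y z
  proof -
    have "y \<in> obj C" "z \<in> obj C" using that by (auto simp: iso_objs_def)
    moreover have "num_chains C n y = num_chains C n z" for n
      using iso_invariantD[OF iso_invariant_num_chains that] .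
    ultimately have "fps_of_poly (p y) = fps_of_poly (p z)" by (simp add: u)
    then show ?thesis by simp
  qed
  then show "iso_invariant C (\<lambda>y. poly (p y) (-1) / poly q (-1))"
    by (auto simp: iso_invariant_def)
  show "zeta_op C (\<lambda>y. poly (p y) (-1) / poly q (-1)) y = 1" if "y \<in> obj C" for y
    using zeta_op_numerators[OF u that] q
    by (simp add: zeta_op_def sum_divide_distrib[symmetric])
qed


section \<open>The Burnside ring as a quotient vector space\<close>

abbreviation pm_scale :: "rat \<Rightarrow> ('b \<Rightarrow>\<^sub>0 rat) \<Rightarrow> 'b \<Rightarrow>\<^sub>0 rat" where
  "pm_scale c \<equiv> Poly_Mapping.map ((*) c)"

lemma lookup_pm_scale [simp]: "Poly_Mapping.lookup (pm_scale c v) k = c * Poly_Mapping.lookup v k"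
  by (simp add: Poly_Mapping.map.rep_eq when_def)

lemma keys_pm_scale: "Poly_Mapping.keys (pm_scale c v) \<subseteq> Poly_Mapping.keys v"
  by (auto simp: in_keys_iff)

interpretation pm: vector_space "pm_scale :: rat \<Rightarrow> ('b \<Rightarrow>\<^sub>0 rat) \<Rightarrow> _"
  by unfold_locales (auto intro!: poly_mapping_eqI simp: lookup_add algebra_simps)

text \<open>With this, an identity in the Burnside ring becomes membership of a difference in a
  subspace, accessible to linear algebra on representatives.\<close>

lemma subspace_burnside_relations: "pm.subspace (burnside_relations G)"
  by (auto simp: pm.subspace_def intro: burnside_relations.intros)

lemmas relations_zero = pm.subspace_0[OF subspace_burnside_relations]
  and relations_add = pm.subspace_add[OF subspace_burnside_relations]
  and relations_diff = pm.subspace_diff[OF subspace_burnside_relations]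
  and relations_neg = pm.subspace_neg[OF subspace_burnside_relations]
  and relations_scale = pm.subspace_scale[OF subspace_burnside_relations]

section \<open>Cosets and the linear operations of the Burnside ring\<close>

abbreviation free_gsets :: "('g, 'z) monoid_scheme \<Rightarrow> ('g nat_gset \<Rightarrow>\<^sub>0 rat) set" where
  "free_gsets G \<equiv> carrier (free_gset_module G)"

lemma free_gsets_iff: "v \<in> free_gsets G \<longleftrightarrow> Poly_Mapping.keys v \<subseteq> nat_gsets G"
  by (simp add: free_gset_module_def)

lemma subspace_free_gsets: "pm.subspace (free_gsets G)"
proof (rule pm.subspaceI)
  show "0 \<in> free_gsets G" by (simp add: free_gsets_iff)
  show "v + w \<in> free_gsets G" if "v \<in> free_gsets G" "w \<in> free_gsets G" for v w
    using that Poly_Mapping.keys_add[of v w] unfolding free_gsets_iff by blast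
  show "pm_scale c v \<in> free_gsets G" if "v \<in> free_gsets G" for c v
    using that keys_pm_scale[of c v] unfolding free_gsets_iff by blast
qed

lemma single_in_free_gsets: "X \<in> nat_gsets G \<Longrightarrow> Poly_Mapping.single X c \<in> free_gsets G"
  by (simp add: free_gsets_iff)

lemma in_burnside_coset_iff: "u \<in> burnside_coset G v \<longleftrightarrow> u - v \<in> burnside_relations G"
proof -
  have "u = (u - v) + v" by simp
  then show ?thesis by (force simp: a_r_coset_def' free_gset_module_def)
qed

lemma burnside_coset_eq_iff:
  "burnside_coset G v = burnside_coset G w \<longleftrightarrow> v - w \<in> burnside_relations G"
proof
  assume "burnside_coset G v = burnside_coset G w"
  moreover have "v \<in> burnside_coset G v" by (simp add: in_burnside_coset_iff relations_zero)
  ultimately show "v - w \<in> burnside_relations G" by (simp add: in_burnside_coset_iff)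
next
  assume vw: "v - w \<in> burnside_relations G"
  have "u - v \<in> burnside_relations G \<longleftrightarrow> u - w \<in> burnside_relations G" for u
  proof
    assume "u - v \<in> burnside_relations G"
    from relations_add[OF this vw] show "u - w \<in> burnside_relations G" by simp
  next
    assume "u - w \<in> burnside_relations G"
    from relations_diff[OF this vw] show "u - v \<in> burnside_relations G" by simp
  qed
  then show "burnside_coset G v = burnside_coset G w"
    unfolding set_eq_iff in_burnside_coset_iff by blast
qed

lemma burnside_zero: "\<zero>\<^bsub>burnside_ring G\<^esub> = burnside_coset G 0"
  by (auto simp: burnside_ring_def in_burnside_coset_iff)

lemma burnside_carrier: "carrier (burnside_ring G) = burnside_coset G ` free_gsets G"
  by (auto simp: burnside_ring_def A_RCOSETS_def')

lemma burnside_add: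
  "burnside_coset G v \<oplus>\<^bsub>burnside_ring G\<^esub> burnside_coset G w = burnside_coset G (v + w)"
proof -
  have "u \<in> burnside_coset G v <+>\<^bsub>free_gset_module G\<^esub> burnside_coset G w
      \<longleftrightarrow> u \<in> burnside_coset G (v + w)" for u
  proof
    assume "u \<in> burnside_coset G v <+>\<^bsub>free_gset_module G\<^esub> burnside_coset G w"
    then obtain a b where ab: "a - v \<in> burnside_relations G" "b - w \<in> burnside_relations G"
      and u: "u = a + b"
      by (auto simp: set_add_def' in_burnside_coset_iff) (simp add: free_gset_module_def)
    have "(a - v) + (b - w) = u - (v + w)" by (simp add: u)
    then show "u \<in> burnside_coset G (v + w)"
      using relations_add[OF ab] by (simp only: in_burnside_coset_iff)
  next
    assume "u \<in> burnside_coset G (v + w)"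
    then have "u - w \<in> burnside_coset G v" by (simp add: in_burnside_coset_iff algebra_simps)
    moreover have "w \<in> burnside_coset G w" by (simp add: in_burnside_coset_iff relations_zero)
    moreover have "u = (u - w) \<oplus>\<^bsub>free_gset_module G\<^esub> w" by (simp add: free_gset_module_def)
    ultimately show "u \<in> burnside_coset G v <+>\<^bsub>free_gset_module G\<^esub> burnside_coset G w"
      unfolding set_add_def' by blast
  qed
  then show ?thesis by (auto simp: burnside_ring_def)
qed

text \<open>The scalar multiple is defined as a union over all representatives; since relations are
  closed under scaling, all cosets in that union coincide.\<close>

lemma burnside_smult:
  "c \<odot>\<^bsub>burnside_ring G\<^esub> burnside_coset G v = burnside_coset G (pm_scale c v)"
proof -
  have const: "\<forall>a\<in>burnside_coset G v. burnside_coset G (pm_scale c a) = burnside_coset G (pm_scale c v)"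
    using relations_scale[of _ G c]
    by (simp add: burnside_coset_eq_iff in_burnside_coset_iff pm.scale_right_diff_distrib[symmetric])
  have v: "v \<in> burnside_coset G v" by (simp add: in_burnside_coset_iff relations_zero)
  have "c \<odot>\<^bsub>burnside_ring G\<^esub> burnside_coset G v =
      (\<Union>a\<in>burnside_coset G v. burnside_coset G (pm_scale c a))"
    by (simp add: burnside_ring_def) (simp add: free_gset_module_def)
  also have "\<dots> = burnside_coset G (pm_scale c v)" by (rule UN_constant_eq[OF v const])
  finally show ?thesis .
qed

lemma abelian_monoid_burnside: "abelian_monoid (burnside_ring G)"
  using pm.subspace_add[OF subspace_free_gsets] pm.subspace_0[OF subspace_free_gsets]
  by (intro abelian_monoidI)
    (auto simp: burnside_carrier burnside_zero burnside_add add_ac intro!: imageI)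

lemma burnside_finsum:
  assumes "finite I" and "\<And>i. i \<in> I \<Longrightarrow> v i \<in> free_gsets G"
  shows "(\<Oplus>\<^bsub>burnside_ring G\<^esub>i\<in>I. burnside_coset G (v i)) = burnside_coset G (\<Sum>i\<in>I. v i)"
  using assms
proof (induction I rule: finite_induct)
  case empty
  then show ?case
    by (simp add: abelian_monoid.finsum_empty[OF abelian_monoid_burnside] burnside_zero)
next
  case (insert i I)
  then show ?case
    by (subst abelian_monoid.finsum_insert[OF abelian_monoid_burnside])
      (auto simp: burnside_carrier burnside_add)
qed

text \<open>Moves a linear combination in the Burnside ring to representatives. Keeping
  \<open>\<omega>\<close> apart from \<open>v\<close> lets it apply to arbitrary elements once
  representatives are chosen.\<close>

lemma burnside_finsum_smult:
  assumes "finite I" and v: "\<And>i. i \<in> I \<Longrightarrow> v i \<in> free_gsets G"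
    and \<omega>: "\<And>i. i \<in> I \<Longrightarrow> \<omega> i = burnside_coset G (v i)"
  shows "(\<Oplus>\<^bsub>burnside_ring G\<^esub>i\<in>I. c i \<odot>\<^bsub>burnside_ring G\<^esub> \<omega> i) =
    burnside_coset G (\<Sum>i\<in>I. pm_scale (c i) (v i))"
proof -
  have cv: "pm_scale (c i) (v i) \<in> free_gsets G" if "i \<in> I" for i
    using pm.subspace_scale[OF subspace_free_gsets v[OF that]] .
  have "(\<Oplus>\<^bsub>burnside_ring G\<^esub>i\<in>I. c i \<odot>\<^bsub>burnside_ring G\<^esub> \<omega> i) =
      (\<Oplus>\<^bsub>burnside_ring G\<^esub>i\<in>I. burnside_coset G (pm_scale (c i) (v i)))"
    using cv
    by (intro abelian_monoid.finsum_cong'[OF abelian_monoid_burnside])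
      (auto simp: \<omega> burnside_smult burnside_carrier)
  then show ?thesis using burnside_finsum[OF assms(1) cv] by simp
qed


section \<open>Classes of finite G-sets\<close>

lemma finite_gsetD:
  assumes "finite_gset G E \<phi>"
  shows "group G" "finite E"
    and "\<And>g x. \<lbrakk>g \<in> carrier G; x \<in> E\<rbrakk> \<Longrightarrow> \<phi> g x \<in> E"
    and "\<And>x. x \<in> E \<Longrightarrow> \<phi> \<one>\<^bsub>G\<^esub> x = x"
    and "\<And>g h x. \<lbrakk>g \<in> carrier G; h \<in> carrier G; x \<in> E\<rbrakk> \<Longrightarrow> \<phi> (g \<otimes>\<^bsub>G\<^esub> h) x = \<phi> g (\<phi> h x)"
  using assms group_actionD[of G E \<phi>] unfolding finite_gset_def by blast+

text \<open>The \<open>restrict\<close> is forced by the extensionality built into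
  \<open>group_action\<close>.\<close>

lemma finite_gset_subset:
  assumes "finite_gset G E \<phi>" "E' \<subseteq> E"
    and closed: "\<And>g x. \<lbrakk>g \<in> carrier G; x \<in> E'\<rbrakk> \<Longrightarrow> \<phi> g x \<in> E'"
  shows "finite_gset G E' (\<lambda>g. restrict (\<phi> g) E')"
proof -
  note E = finite_gsetD[OF assms(1)]
  have "group_action G E' (\<lambda>g. restrict (\<phi> g) E')"
    by (rule group_actionI[OF E(1)]) (use E closed assms(2) in auto)
  then show ?thesis using finite_subset[OF assms(2) E(2)] by (simp add: finite_gset_def)
qed

text \<open>Closure is assumed in place of \<open>group_action\<close>, so that a subset may keep
  the unrestricted action of the ambient set.\<close>

lemma gset_isomorphic_sym:
  assumes "gset_isomorphic G E \<phi> E' \<psi>"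
    and "\<And>g x. \<lbrakk>g \<in> carrier G; x \<in> E\<rbrakk> \<Longrightarrow> \<phi> g x \<in> E"
  shows "gset_isomorphic G E' \<psi> E \<phi>"
proof -
  obtain f where f: "bij_betw f E E'"
    and eq: "\<And>g x. \<lbrakk>g \<in> carrier G; x \<in> E\<rbrakk> \<Longrightarrow> f (\<phi> g x) = \<psi> g (f x)"
    using assms(1) unfolding gset_isomorphic_def equivariant_def by blast
  let ?h = "inv_into E f"
  have "?h (\<psi> g y) = \<phi> g (?h y)" if g: "g \<in> carrier G" and y: "y \<in> E'" for g y
  proof -
    have "?h y \<in> E" "f (?h y) = y"
      using f y by (auto simp: bij_betw_def inv_into_into f_inv_into_f)
    then show ?thesis
      using eq[OF g, of "?h y"] assms(2)[OF g, of "?h y"] f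
      by (metis bij_betw_inv_into_left)
  qed
  moreover have "?h \<in> E' \<rightarrow> E" using bij_betw_inv_into[OF f] by (auto simp: bij_betw_def)
  ultimately show ?thesis
    using bij_betw_inv_into[OF f] unfolding gset_isomorphic_def equivariant_def by blast
qed

lemma gset_isomorphic_trans:
  assumes "gset_isomorphic G E \<phi> E' \<psi>" "gset_isomorphic G E' \<psi> E'' \<chi>"
  shows "gset_isomorphic G E \<phi> E'' \<chi>"
proof -
  obtain f where "bij_betw f E E'" "equivariant G E \<phi> E' \<psi> f"
    using assms(1) unfolding gset_isomorphic_def by blast
  moreover obtain h where "bij_betw h E' E''" "equivariant G E' \<psi> E'' \<chi> h"
    using assms(2) unfolding gset_isomorphic_def by blast
  ultimately have "bij_betw (h \<circ> f) E E''" "equivariant G E \<phi> E'' \<chi> (h \<circ> f)"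
    by (auto simp: equivariant_def Pi_iff intro: bij_betw_trans)
  then show ?thesis unfolding gset_isomorphic_def by blast
qed

lemma gset_isomorphic_restrict: "gset_isomorphic G E \<phi> E (\<lambda>g. restrict (\<phi> g) E)"
  unfolding gset_isomorphic_def equivariant_def by (rule exI[of _ id]) auto

lemma gset_isomorphic_image:
  assumes "bij_betw f E E'" "equivariant G E \<phi> E' \<psi> f" "D \<subseteq> E"
  shows "gset_isomorphic G D (\<lambda>g. restrict (\<phi> g) D) (f ` D) (\<lambda>g. restrict (\<psi> g) (f ` D))"
  unfolding gset_isomorphic_def equivariant_def
proof (intro exI[of _ f] conjI)
  show "bij_betw f D (f ` D)"
    using assms by (auto simp: bij_betw_def intro: inj_on_subset)
qed (use assms in \<open>auto simp: equivariant_def\<close>)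

text \<open>Transport the action along an enumeration of \<open>E\<close>. This makes the choice in
  \<open>burnside_class\<close> meaningful.\<close>

lemma exists_nat_gset:
  assumes "finite_gset G E \<phi>"
  shows "\<exists>X. X \<in> nat_gsets G \<and> gset_isomorphic G E \<phi> (fst X) (snd X)"
proof -
  note E = finite_gsetD[OF assms]
  obtain f where f: "bij_betw f E {0..<card E}" using ex_bij_betw_finite_nat[OF E(2)] by blast
  let ?N = "{0..<card E}"
  let ?h = "inv_into E f"
  let ?\<psi> = "\<lambda>g. \<lambda>n\<in>?N. f (\<phi> g (?h n))"
  have h: "?h n \<in> E" "f (?h n) = n" if "n \<in> ?N" for n
    using f that by (metis bij_betw_def inv_into_into, metis bij_betw_inv_into_right)
  have f1: "f x \<in> ?N" "?h (f x) = x" if "x \<in> E" for x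
    using f that by (metis bij_betwE, metis bij_betw_inv_into_left)
  have "group_action G ?N ?\<psi>"
    by (rule group_actionI[OF E(1)])
      (use E h f1 group.is_monoid[OF E(1)] in \<open>simp_all add: monoid.m_closed del: atLeastLessThan_iff\<close>)
  then have "(?N, ?\<psi>) \<in> nat_gsets G" by (simp add: nat_gsets_def finite_gset_def)
  moreover have "gset_isomorphic G E \<phi> ?N ?\<psi>"
    unfolding gset_isomorphic_def equivariant_def
    using f f1 by (intro exI[of _ f]) auto
  ultimately show ?thesis by (intro exI[of _ "(?N, ?\<psi>)"]) simp
qed

text \<open>The representative inside \<open>burnside_class\<close>, named for computing before
  passing to cosets. It depends on \<open>\<phi>\<close> only through its values on
  \<open>E\<close>, so subsets can be used with the ambient action.\<close>

definition gset_generator ::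
    "('g, 'z) monoid_scheme \<Rightarrow> 'x set \<Rightarrow> ('g \<Rightarrow> 'x \<Rightarrow> 'x) \<Rightarrow> ('g nat_gset \<Rightarrow>\<^sub>0 rat)" where
  "gset_generator G E \<phi> = Poly_Mapping.single
     (SOME X. X \<in> nat_gsets G \<and> gset_isomorphic G E \<phi> (fst X) (snd X)) 1"

lemma burnside_class_eq: "burnside_class G E \<phi> = burnside_coset G (gset_generator G E \<phi>)"
  by (simp add: burnside_class_def gset_generator_def)

lemma gset_generatorE:
  assumes "finite_gset G E \<phi>"
  obtains X \<psi> where "(X, \<psi>) \<in> nat_gsets G" "gset_isomorphic G E \<phi> X \<psi>"
    "gset_generator G E \<phi> = Poly_Mapping.single (X, \<psi>) 1"
proof -
  define X where "X = (SOME X. X \<in> nat_gsets G \<and> gset_isomorphic G E \<phi> (fst X) (snd X))"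
  have "X \<in> nat_gsets G \<and> gset_isomorphic G E \<phi> (fst X) (snd X)"
    unfolding X_def by (rule someI_ex[OF exists_nat_gset[OF assms]])
  moreover have "gset_generator G E \<phi> = Poly_Mapping.single X 1"
    by (simp add: gset_generator_def X_def)
  ultimately show ?thesis using that[of "fst X" "snd X"] by simp
qed

lemma gset_generator_in_free_gsets:
  "finite_gset G E \<phi> \<Longrightarrow> gset_generator G E \<phi> \<in> free_gsets G"
  by (erule gset_generatorE) (simp only: single_in_free_gsets)

text \<open>Isomorphic G-sets define the same predicate under \<open>SOME\<close>, so the generators
  are equal outright and not merely modulo relations.\<close>

lemma gset_generator_cong:
  assumes "gset_isomorphic G E \<phi> E' \<psi>"
    and "\<And>g x. \<lbrakk>g \<in> carrier G; x \<in> E\<rbrakk> \<Longrightarrow> \<phi> g x \<in> E"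
  shows "gset_generator G E \<phi> = gset_generator G E' \<psi>"
proof -
  have "gset_isomorphic G E \<phi> X \<chi> \<longleftrightarrow> gset_isomorphic G E' \<psi> X \<chi>"
    for X :: "nat set" and \<chi>
    using gset_isomorphic_trans[OF assms(1)] gset_isomorphic_trans[OF gset_isomorphic_sym[OF assms]]
    by blast
  then show ?thesis by (simp add: gset_generator_def)
qed

lemma gset_generator_nat:
  assumes X: "(X, \<psi>) \<in> nat_gsets G" and "finite_gset G E \<phi>" "gset_isomorphic G E \<phi> X \<psi>"
  shows "gset_generator G E \<phi> - Poly_Mapping.single (X, \<psi>) 1 \<in> burnside_relations G"
proof -
  obtain Y \<chi> where Y: "(Y, \<chi>) \<in> nat_gsets G" "gset_isomorphic G E \<phi> Y \<chi>"
    and eq: "gset_generator G E \<phi> = Poly_Mapping.single (Y, \<chi>) 1"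
    using gset_generatorE[OF assms(2)] .
  have "gset_isomorphic G Y \<chi> X \<psi>"
    using gset_isomorphic_trans[OF gset_isomorphic_sym[OF Y(2)] assms(3)] finite_gsetD(3)[OF assms(2)]
    by blast
  then show ?thesis unfolding eq by (rule burnside_relations.iso[OF Y(1) X])
qed

text \<open>The representatives chosen for the three sets are unrelated, whereas the relation
  \<open>disjoint_union\<close> speaks of an actual union. Hence both parts are carried into the
  representative \<open>X\<close> of \<open>E\<close>, the relation is applied to their images, and
  the images are exchanged for the chosen representatives.\<close>

lemma gset_generator_Un:
  assumes E: "finite_gset G E \<phi>" and "E = E\<^sub>1 \<union> E\<^sub>2" "E\<^sub>1 \<inter> E\<^sub>2 = {}"
    and cl1: "\<And>g x. \<lbrakk>g \<in> carrier G; x \<in> E\<^sub>1\<rbrakk> \<Longrightarrow> \<phi> g x \<in> E\<^sub>1"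
    and cl2: "\<And>g x. \<lbrakk>g \<in> carrier G; x \<in> E\<^sub>2\<rbrakk> \<Longrightarrow> \<phi> g x \<in> E\<^sub>2"
  shows "gset_generator G E \<phi> - gset_generator G E\<^sub>1 \<phi> - gset_generator G E\<^sub>2 \<phi>
    \<in> burnside_relations G"
proof -
  obtain X \<psi> where X: "(X, \<psi>) \<in> nat_gsets G" "gset_isomorphic G E \<phi> X \<psi>"
    and eq: "gset_generator G E \<phi> = Poly_Mapping.single (X, \<psi>) 1"
    using gset_generatorE[OF E] .
  obtain f where f: "bij_betw f E X" "equivariant G E \<phi> X \<psi> f"
    using X(2) unfolding gset_isomorphic_def by blast
  let ?r = "\<lambda>D g. restrict (\<psi> g) (f ` D)"
  have part: "(f ` D, ?r D) \<in> nat_gsets G"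
      "gset_generator G D \<phi> - Poly_Mapping.single (f ` D, ?r D) 1 \<in> burnside_relations G"
    if D: "D \<subseteq> E" and cl: "\<And>g x. \<lbrakk>g \<in> carrier G; x \<in> D\<rbrakk> \<Longrightarrow> \<phi> g x \<in> D" for D
  proof -
    have fD: "\<psi> g (f x) = f (\<phi> g x)" if "g \<in> carrier G" "x \<in> D" for g x
      using f(2) that D by (auto simp: equivariant_def)
    have "finite_gset G X \<psi>" using X(1) by (simp add: nat_gsets_def)
    moreover have "f ` D \<subseteq> X" using f(1) D by (auto simp: bij_betw_def)
    ultimately have "finite_gset G (f ` D) (?r D)"
      using fD cl by (intro finite_gset_subset) auto
    then show nat: "(f ` D, ?r D) \<in> nat_gsets G" by (simp add: nat_gsets_def)
    have "gset_generator G D \<phi> = gset_generator G D (\<lambda>g. restrict (\<phi> g) D)"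
      by (rule gset_generator_cong[OF gset_isomorphic_restrict cl])
    then show "gset_generator G D \<phi> - Poly_Mapping.single (f ` D, ?r D) 1 \<in> burnside_relations G"
      using gset_generator_nat[OF nat finite_gset_subset[OF E D cl] gset_isomorphic_image[OF f D]]
      by simp
  qed
  have "E\<^sub>1 \<subseteq> E" "E\<^sub>2 \<subseteq> E" using assms(2) by auto
  note p1 = part[OF this(1) cl1] and p2 = part[OF this(2) cl2]
  have "f ` E\<^sub>1 \<inter> f ` E\<^sub>2 = {}"
    using f(1) assms(2,3) inj_on_image_Int[of f E E\<^sub>1 E\<^sub>2] by (auto simp: bij_betw_def)
  moreover have "X = f ` E\<^sub>1 \<union> f ` E\<^sub>2"
    using f(1) assms(2) by (metis bij_betw_imp_surj_on image_Un)
  ultimately have "Poly_Mapping.single (X, \<psi>) 1 - Poly_Mapping.single (f ` E\<^sub>1, ?r E\<^sub>1) 1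
      - Poly_Mapping.single (f ` E\<^sub>2, ?r E\<^sub>2) 1 \<in> burnside_relations G"
    using X(1) p1(1) p2(1) by (intro burnside_relations.disjoint_union) auto
  from relations_diff[OF relations_diff[OF this p1(2)] p2(2)]
  show ?thesis by (simp add: eq algebra_simps)
qed

text \<open>Fibres of an invariant map are invariant subsets; they are split off one at a
  time.\<close>

lemma gset_generator_fibres:
  assumes "finite J" and "finite_gset G E \<phi>" and "\<pi> ` E \<subseteq> J"
    and "\<And>g x. \<lbrakk>g \<in> carrier G; x \<in> E\<rbrakk> \<Longrightarrow> \<pi> (\<phi> g x) = \<pi> x"
  shows "gset_generator G E \<phi> - (\<Sum>j\<in>J. gset_generator G {x \<in> E. \<pi> x = j} \<phi>)
    \<in> burnside_relations G"
  using assms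
proof (induction J arbitrary: E \<phi> rule: finite_induct)
  case empty
  then have "E = {}" by simp
  \<comment> \<open>Writing the empty set as the union of two empty sets gives
    \<open>[E] - [E] - [E]\<close> as a relation.\<close>
  then have "- gset_generator G E \<phi> \<in> burnside_relations G"
    using gset_generator_Un[OF empty.prems(1), of E E] by simp
  from relations_neg[OF this] show ?case by simp
next
  case (insert j J)
  note E = finite_gsetD[OF insert.prems(1)]
  let ?E1 = "{x \<in> E. \<pi> x = j}"
  let ?E2 = "{x \<in> E. \<pi> x \<in> J}"
  \<comment> \<open>The induction hypothesis asks for a genuine G-set, hence the restricted action;
    the generators do not notice the change.\<close>
  let ?\<phi> = "\<lambda>g. restrict (\<phi> g) ?E2"
  have cl2: "\<phi> g x \<in> ?E2" if "g \<in> carrier G" "x \<in> ?E2" for g x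
    using E(3)[OF that(1)] insert.prems(3)[OF that(1)] that by auto
  have split: "gset_generator G E \<phi> - gset_generator G ?E1 \<phi> - gset_generator G ?E2 \<phi>
      \<in> burnside_relations G"
    using insert.prems E(3) insert.hyps(2) by (intro gset_generator_Un) auto
  have fin2: "finite_gset G ?E2 ?\<phi>"
    using finite_gset_subset[OF insert.prems(1) _ cl2] by auto
  have IH: "gset_generator G ?E2 ?\<phi> - (\<Sum>i\<in>J. gset_generator G {x \<in> ?E2. \<pi> x = i} ?\<phi>)
      \<in> burnside_relations G"
    using insert.prems(3) by (intro insert.IH[OF fin2]) auto
  have gen2: "gset_generator G ?E2 ?\<phi> = gset_generator G ?E2 \<phi>"
    by (rule gset_generator_cong[OF gset_isomorphic_restrict cl2, symmetric])
  have "gset_generator G {x \<in> ?E2. \<pi> x = i} ?\<phi> = gset_generator G {x \<in> E. \<pi> x = i} \<phi>"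
    if i: "i \<in> J" for i
  proof -
    have "{x \<in> ?E2. \<pi> x = i} = {x \<in> E. \<pi> x = i}" using i by auto
    moreover have "gset_isomorphic G {x \<in> E. \<pi> x = i} \<phi> {x \<in> E. \<pi> x = i} ?\<phi>"
      unfolding gset_isomorphic_def equivariant_def using i by (intro exI[of _ id]) auto
    then have "gset_generator G {x \<in> E. \<pi> x = i} \<phi> = gset_generator G {x \<in> E. \<pi> x = i} ?\<phi>"
      using E(3) insert.prems(3) by (intro gset_generator_cong) auto
    ultimately show ?thesis by simp
  qed
  with IH have "gset_generator G ?E2 \<phi> - (\<Sum>i\<in>J. gset_generator G {x \<in> E. \<pi> x = i} \<phi>)
      \<in> burnside_relations G" by (simp add: gen2)
  from relations_add[OF split this] show ?case
    using insert.hyps by (simp add: algebra_simps)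
qed


section \<open>Evaluation at minus one\<close>

text \<open>The coefficients of \<open>r\<close> may start at a negative index, so the convolution
  runs over all of \<open>Q\<close> and is not cut off at \<open>n\<close>.\<close>

lemma fls_nth_poly_mult:
  fixes r :: "'k::field fls"
  shows "degree Q \<le> N \<Longrightarrow> fls_nth (fps_to_fls (fps_of_poly Q) * r) n =
    (\<Sum>k\<le>N. coeff Q k * fls_nth r (n - int k))"
proof (induction Q arbitrary: N n rule: pCons_induct)
  case 0
  then show ?case by simp
next
  case (pCons a Q)
  have *: "fps_to_fls (fps_of_poly (pCons a Q)) * r =
      fls_const a * r + fls_X * (fps_to_fls (fps_of_poly Q) * r)"
    by (simp add: fps_of_poly_pCons fls_times_fps_to_fls algebra_simps)
  show ?case
  proof (cases N)
    case 0
    with pCons show ?thesis by (auto simp: * split: if_splits)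
  next
    case (Suc M)
    have "degree Q \<le> M" using pCons.prems Suc by (auto split: if_splits)
    then show ?thesis
      unfolding * Suc sum.atMost_Suc_shift
      by (simp add: pCons.IH fls_X_times_conv_shift diff_diff_eq)
  qed
qed

text \<open>Clearing denominators replaces the rational functions by polynomials, whose value at \<open>-1\<close> is
  a linear combination of coefficients.\<close>

lemma ratfun_value_in_subspace:
  fixes v :: "'i \<Rightarrow> 'b \<Rightarrow>\<^sub>0 rat"
  assumes S: "pm.subspace S" and I: "finite I"
    and q: "\<And>i. i \<in> I \<Longrightarrow> \<not> [:1, 1:] dvd q i"
    and coeffs: "\<And>n. (\<Sum>i\<in>I. pm_scale (fls_nth (fls_of_ratfun (p i) (q i)) n) (v i)) \<in> S"
  shows "(\<Sum>i\<in>I. pm_scale (poly (p i) (-1) / poly (q i) (-1)) (v i)) \<in> S"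
proof -
  \<comment> \<open>\<open>Q\<close> is a common denominator, \<open>P i\<close> the numerator of
    the \<open>i\<close>-th fraction over it, and \<open>A n\<close> the coefficient of
    \<open>t^n\<close> after multiplying the whole combination by \<open>Q\<close>.\<close>
  define Q where "Q = (\<Prod>i\<in>I. q i)"
  define P where "P i = p i * (\<Prod>j\<in>I - {i}. q j)" for i
  define r where "r i = fls_of_ratfun (p i) (q i)" for i
  define A where "A n = (\<Sum>i\<in>I. pm_scale (coeff (P i) n) (v i))" for n
  define N where "N = (\<Sum>i\<in>I. degree (P i))"
  have qv: "poly (q i) (-1) \<noteq> 0" if "i \<in> I" for i
    using q[OF that] by (simp add: poly_eq_0_iff_dvd)
  have Q_eq: "Q = q i * (\<Prod>j\<in>I - {i}. q j)" if "i \<in> I" for i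
    using I that by (simp add: Q_def prod.remove)
  have "fps_to_fls (fps_of_poly Q) * r i = fps_to_fls (fps_of_poly (P i))" if i: "i \<in> I" for i
  proof -
    have "q i \<noteq> 0" using q[OF i] by auto
    then show ?thesis
      by (simp add: Q_eq[OF i] P_def r_def fls_of_ratfun_def fps_of_poly_mult fls_times_fps_to_fls)
  qed
  then have "coeff (P i) n = fls_nth (fps_to_fls (fps_of_poly Q) * r i) (int n)" if "i \<in> I" for i n
    using that by simp
  then have P_coeff: "coeff (P i) n = (\<Sum>k\<le>degree Q. coeff Q k * fls_nth (r i) (int n - int k))"
    if "i \<in> I" for i n
    using that by (simp add: fls_nth_poly_mult[OF order.refl])
  have "A n = (\<Sum>k\<le>degree Q. pm_scale (coeff Q k)
      (\<Sum>i\<in>I. pm_scale (fls_nth (r i) (int n - int k)) (v i)))" for n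
    unfolding A_def pm.scale_sum_right
    by (subst sum.swap) (simp add: P_coeff pm.scale_sum_left)
  \<comment> \<open>\<open>A n\<close> combines given coefficients at the indices
    \<open>n - k\<close>, some of them possibly negative; \<open>coeffs\<close> covers all
    integers.\<close>
  then have A: "A n \<in> S" for n
    by (simp only: r_def) (rule pm.subspace_sum[OF S], rule pm.subspace_scale[OF S], rule coeffs)
  have "poly (P i) (-1) = (\<Sum>n\<le>N. (-1) ^ n * coeff (P i) n)" if "i \<in> I" for i
  proof -
    have "degree (P i) \<le> N" unfolding N_def using I that by (intro member_le_sum) auto
    then show ?thesis unfolding poly_altdef
      by (intro sum.mono_neutral_cong_left) (auto simp: coeff_eq_0)
  qed
  then have "(\<Sum>i\<in>I. pm_scale (poly (P i) (-1)) (v i)) = (\<Sum>n\<le>N. pm_scale ((-1) ^ n) (A n))"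
    unfolding A_def pm.scale_sum_right
    by (subst sum.swap) (simp add: pm.scale_sum_left)
  then have "(\<Sum>i\<in>I. pm_scale (poly (P i) (-1)) (v i)) \<in> S"
    by (simp only:) (rule pm.subspace_sum[OF S], rule pm.subspace_scale[OF S], rule A)
  then have "pm_scale (1 / poly Q (-1)) (\<Sum>i\<in>I. pm_scale (poly (P i) (-1)) (v i)) \<in> S"
    by (rule pm.subspace_scale[OF S])
  moreover have "1 / poly Q (-1) * poly (P i) (-1) = poly (p i) (-1) / poly (q i) (-1)"
    if i: "i \<in> I" for i
    using qv I by (auto simp: Q_eq[OF i] P_def poly_prod)
  ultimately show ?thesis by (simp add: pm.scale_sum_right)
qed

lemma value_at_minus_oneE:
  assumes "value_at_minus_one G f c"
  obtains m :: nat and v p q where "\<And>i. i < m \<Longrightarrow> \<not> [:1, 1:] dvd q i"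
    "\<And>n. (if n < 0 then \<zero>\<^bsub>burnside_ring G\<^esub> else f (nat n)) =
      burnside_coset G (\<Sum>i<m. pm_scale (fls_nth (fls_of_ratfun (p i) (q i)) n) (v i))"
    "c = burnside_coset G (\<Sum>i<m. pm_scale (poly (p i) (-1) / poly (q i) (-1)) (v i))"
proof -
  obtain m :: nat and \<omega> p q where
    \<omega>: "\<And>i. i < m \<Longrightarrow> \<omega> i \<in> carrier (burnside_ring G) \<and> \<not> [:1, 1:] dvd q i"
    and f: "\<And>n. (if n < 0 then \<zero>\<^bsub>burnside_ring G\<^esub> else f (nat n)) =
       (\<Oplus>\<^bsub>burnside_ring G\<^esub>i \<in> {..<m}. fls_nth (fls_of_ratfun (p i) (q i)) n \<odot>\<^bsub>burnside_ring G\<^esub> \<omega> i)"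
    and c: "c = (\<Oplus>\<^bsub>burnside_ring G\<^esub>i \<in> {..<m}.
      (poly (p i) (-1) / poly (q i) (-1)) \<odot>\<^bsub>burnside_ring G\<^esub> \<omega> i)"
    using assms unfolding value_at_minus_one_def by blast
  have "\<forall>i\<in>{..<m}. \<exists>v. v \<in> free_gsets G \<and> \<omega> i = burnside_coset G v"
    using \<omega> by (auto simp: burnside_carrier)
  then obtain v where v: "\<And>i. i \<in> {..<m} \<Longrightarrow> v i \<in> free_gsets G"
      "\<And>i. i \<in> {..<m} \<Longrightarrow> \<omega> i = burnside_coset G (v i)" by (auto dest!: bchoice)
  note fs = burnside_finsum_smult[OF finite_lessThan v]
  show ?thesis
  proof (rule that)
    show "\<not> [:1, 1:] dvd q i" if "i < m" for i using \<omega>[OF that] by blast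
    show "(if n < 0 then \<zero>\<^bsub>burnside_ring G\<^esub> else f (nat n)) =
        burnside_coset G (\<Sum>i<m. pm_scale (fls_nth (fls_of_ratfun (p i) (q i)) n) (v i))" for n
      unfolding f by (rule fs)
    show "c = burnside_coset G (\<Sum>i<m. pm_scale (poly (p i) (-1) / poly (q i) (-1)) (v i))"
      unfolding c by (rule fs)
  qed
qed

text \<open>Two presentations of \<open>f\<close> are joined over a disjoint sum of index sets, the
  second with a minus sign. All coefficients of the result are relations, hence so is its value at
  \<open>-1\<close>.\<close>

lemma value_at_minus_one_unique:
  assumes "value_at_minus_one G f a" "value_at_minus_one G f b"
  shows "a = b"
proof -
  obtain m :: nat and v p q where v: "\<And>i. i < m \<Longrightarrow> \<not> [:1, 1:] dvd q i"
      "\<And>n. (if n < 0 then \<zero>\<^bsub>burnside_ring G\<^esub> else f (nat n)) =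
        burnside_coset G (\<Sum>i<m. pm_scale (fls_nth (fls_of_ratfun (p i) (q i)) n) (v i))"
      "a = burnside_coset G (\<Sum>i<m. pm_scale (poly (p i) (-1) / poly (q i) (-1)) (v i))"
    by (rule value_at_minus_oneE[OF assms(1)], rule that)
  obtain m' :: nat and v' p' q' where v': "\<And>i. i < m' \<Longrightarrow> \<not> [:1, 1:] dvd q' i"
      "\<And>n. (if n < 0 then \<zero>\<^bsub>burnside_ring G\<^esub> else f (nat n)) =
        burnside_coset G (\<Sum>i<m'. pm_scale (fls_nth (fls_of_ratfun (p' i) (q' i)) n) (v' i))"
      "b = burnside_coset G (\<Sum>i<m'. pm_scale (poly (p' i) (-1) / poly (q' i) (-1)) (v' i))"
    by (rule value_at_minus_oneE[OF assms(2)], rule that)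
  define w where "w = case_sum v (\<lambda>i. - v' i)"
  have "(\<Sum>i\<in>{..<m} <+> {..<m'}. pm_scale (poly (case_sum p p' i) (-1) / poly (case_sum q q' i) (-1)) (w i))
      \<in> burnside_relations G"
  proof (rule ratfun_value_in_subspace[OF subspace_burnside_relations])
    show "\<not> [:1, 1:] dvd case_sum q q' i" if "i \<in> {..<m} <+> {..<m'}" for i
      using that v(1) v'(1) by auto
    show "(\<Sum>i\<in>{..<m} <+> {..<m'}. pm_scale (fls_nth (fls_of_ratfun (case_sum p p' i) (case_sum q q' i)) n) (w i))
        \<in> burnside_relations G" for n
      using trans[OF v(2)[symmetric] v'(2), of n]
      by (simp add: sum.Plus w_def burnside_coset_eq_iff sum_negf)
  qed simp
  then show ?thesis
    by (simp add: sum.Plus w_def v(3) v'(3) burnside_coset_eq_iff sum_negf)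
qed


section \<open>Chains of the Grothendieck construction\<close>

lemma is_chain_mor: "is_chain D x fs \<Longrightarrow> set fs \<subseteq> mor D"
  by (induction fs arbitrary: x) auto

text \<open>The point to check is that no morphism becomes an identity: acting by the inverse would
  exhibit the original one as an identity.\<close>

lemma (in gcategory) is_chain_act:
  assumes g: "g \<in> carrier G"
  shows "is_chain D x fs \<Longrightarrow> is_chain D (obj_act D g x) (map (mor_act D g) fs)"
proof (induction fs arbitrary: x)
  case Nil
  then show ?case using group_actionD(2)[OF obj_action g] by simp
next
  case (Cons f fs)
  then have f: "f \<in> mor D" "f \<notin> idt D ` obj D" by auto
  have "mor_act D g f \<notin> idt D ` obj D"
  proof
    assume "mor_act D g f \<in> idt D ` obj D"
    then obtain y where y: "y \<in> obj D" "mor_act D g f = idt D y" by blast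
    have "f = mor_act D (inv g \<otimes> g) f" using f g group_actionD(3)[OF mor_action] by simp
    also have "\<dots> = mor_act D (inv g) (idt D y)"
      using f g y group_actionD(4)[OF mor_action, of "inv g" g f] by simp
    also have "\<dots> = idt D (obj_act D (inv g) y)" using g y idt_act by simp
    finally show False using f g y group_actionD(2)[OF obj_action, of "inv g" y] by auto
  qed
  then show ?case
    using Cons f g group_actionD(2)[OF mor_action g] by (auto simp: src_act tgt_act)
qed

lemma (in gcategory) finite_gset_chains:
  assumes "finite (chains D n)"
  shows "finite_gset G (chains D n) (chain_act D n)"
proof -
  have "group_action G (chains D n) (chain_act D n)"
  proof (rule group_actionI)
    fix c assume "c \<in> chains D n"
    then obtain x fs where c: "c = (x, fs)" "length fs = n" "is_chain D x fs"
      by (auto simp: chains_def)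
    note m = is_chain_mor[OF c(3)] is_chain_obj[OF category_axioms c(3)]
    have cl: "(obj_act D g x, map (mor_act D g) fs) \<in> chains D n" if "g \<in> carrier G" for g
      using is_chain_act[OF that c(3)] c(2) by (simp add: chains_def)
    show "chain_act D n g c \<in> chains D n" if "g \<in> carrier G" for g
      using cl[OF that] c by (auto simp: chain_act_def chains_def)
    show "chain_act D n \<one> c = c"
      using m c group_actionD(3)[OF mor_action] group_actionD(3)[OF obj_action]
      by (auto simp: chain_act_def chains_def intro!: map_idI)
    show "chain_act D n (g \<otimes> h) c = chain_act D n g (chain_act D n h c)"
      if "g \<in> carrier G" "h \<in> carrier G" for g h
      using m c that cl[OF that(2)] group_actionD(4)[OF mor_action that]
        group_actionD(4)[OF obj_action that]
      by (auto simp: chain_act_def chains_def)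
  qed (auto simp: chain_act_def is_group)
  with assms show ?thesis by (simp add: finite_gset_def)
qed

text \<open>Lifts a chain of \<open>C\<close> to the Grothendieck construction by pushing the
  initial point \<open>a\<close> forward along it.\<close>

fun lift_chain :: "('o, 'm, 'g, 'a, 'w) gset_functor_scheme \<Rightarrow> 'a \<Rightarrow> 'm list \<Rightarrow> ('m \<times> 'a) list" where
  "lift_chain F a [] = []"
| "lift_chain F a (f # fs) = (f, a) # lift_chain F (fmor F f a) fs"

lemma map_fst_lift_chain [simp]: "map fst (lift_chain F a fs) = fs"
  by (induction fs arbitrary: a) auto

lemma (in functor_to_finite_gsets) fmor_closed:
  "f \<in> mor C \<Longrightarrow> a \<in> fobj F (src C f) \<Longrightarrow> fmor F f a \<in> fobj F (tgt C f)"
  using fmor_equivariant by (auto simp: equivariant_def)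

text \<open>A morphism \<open>(f, a)\<close> is an identity exactly when \<open>f\<close> is, and
  its target point is forced. So a chain amounts to its underlying chain in \<open>C\<close> with a
  point over the start.\<close>

lemma (in functor_to_finite_gsets) is_chain_grothendieck:
  "is_chain (grothendieck C F) (x, a) fs \<longleftrightarrow>
    a \<in> fobj F x \<and> is_chain C x (map fst fs) \<and> fs = lift_chain F a (map fst fs)"
proof (induction fs arbitrary: x a)
  case Nil
  then show ?case by (auto simp: grothendieck_def Let_def)
next
  case (Cons p fs)
  obtain f b where p: "p = (f, b)" by force
  have "(f, b) \<in> idt (grothendieck C F) ` obj (grothendieck C F) \<longleftrightarrow> f \<in> idt C ` obj C"
    if "b \<in> fobj F (src C f)"
    using that by (auto simp: grothendieck_def Let_def src_idt image_iff)
  moreover have "p \<in> mor (grothendieck C F) \<longleftrightarrow> f \<in> mor C \<and> b \<in> fobj F (src C f)"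
    "src (grothendieck C F) p = (src C f, b)" "tgt (grothendieck C F) p = (tgt C f, fmor F f b)"
    by (auto simp: p grothendieck_def Let_def)
  ultimately show ?case
    using Cons.IH[of "tgt C f" "fmor F f b"] fmor_closed[of f b] by (auto simp: p)
qed

text \<open>The group moves only the points, so chains lying over one chain of \<open>C\<close> form
  an invariant set. Taking the initial point identifies it with \<open>F x\<close>, and there are
  \<open>num_chains C n x\<close> such sets for each \<open>x\<close>.\<close>

lemma (in functor_to_finite_gsets) gset_generator_chains:
  assumes "finite_category C"
  shows "gset_generator G (chains (grothendieck C F) n) (chain_act (grothendieck C F) n) -
    (\<Sum>x\<in>obj C. pm_scale (num_chains C n x) (gset_generator G (fobj F x) (fobj_act F x)))
    \<in> burnside_relations G"
proof -
  interpret finite_category C by fact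
  let ?D = "grothendieck C F"
  interpret D: gcategory G ?D
    by (rule gcategory_grothendieck) unfold_locales
  have fin: "finite (fobj F x)" if "x \<in> obj C" for x
    using fobj_gset[OF that] by (simp add: finite_gset_def)
  have "finite_category ?D"
    by (intro finite_category.intro D.category_axioms finite_category_axioms.intro)
      (auto simp: grothendieck_def Let_def finite_obj finite_mor fin src_obj)
  then have finD: "finite (chains ?D n)"
    using finite_category.finite_chains_from[of ?D] finite_category.finite_obj[of ?D]
    by (auto simp: chains_conv_Sigma D.category_axioms)
  have finC: "finite (chains C n)"
    using finite_chains_from finite_obj by (auto simp: chains_conv_Sigma category_axioms)
  let ?\<pi> = "\<lambda>c. (fst (fst c), map fst (snd c))"
  let ?E = "chains ?D n" and ?\<phi> = "chain_act ?D n"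
  have E: "finite_gset G ?E ?\<phi>" by (rule D.finite_gset_chains[OF finD])
  have chainE: "((x, a), fs) \<in> ?E \<longleftrightarrow>
      (x, map fst fs) \<in> chains C n \<and> a \<in> fobj F x \<and> fs = lift_chain F a (map fst fs)" for x a fs
    by (auto simp: chains_def is_chain_grothendieck)
  have act: "?\<phi> g ((x, a), fs) = ((x, fobj_act F x g a), map (mor_act ?D g) fs)"
      "map fst (map (mor_act ?D g) fs) = map fst fs"
    if "((x, a), fs) \<in> ?E" for x a fs g
  proof -
    have "is_chain ?D (x, a) fs" using that by (simp add: chains_def)
    from is_chain_obj[OF D.category_axioms this] is_chain_mor[OF this] that
    show "?\<phi> g ((x, a), fs) = ((x, fobj_act F x g a), map (mor_act ?D g) fs)"
        "map fst (map (mor_act ?D g) fs) = map fst fs"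
      by (auto simp: chain_act_def grothendieck_def Let_def)
  qed
  have inv: "?\<pi> (?\<phi> g c) = ?\<pi> c" if "c \<in> ?E" for g c
    using act that by (cases c) auto
  have fibre: "gset_generator G {c \<in> ?E. ?\<pi> c = (x, gs)} ?\<phi> = gset_generator G (fobj F x) (fobj_act F x)"
    if xgs: "(x, gs) \<in> chains C n" for x gs
  proof (rule gset_generator_cong)
    let ?S = "{c \<in> ?E. ?\<pi> c = (x, gs)}"
    have "bij_betw (\<lambda>c. snd (fst c)) ?S (fobj F x)"
      using xgs by (intro bij_betw_byWitness[where f' = "\<lambda>a. ((x, a), lift_chain F a gs)"])
        (auto simp: chainE)
    moreover have "equivariant G ?S ?\<phi> (fobj F x) (fobj_act F x) (\<lambda>c. snd (fst c))"
      by (auto simp: equivariant_def act(1)) (auto simp: chainE)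
    ultimately show "gset_isomorphic G ?S ?\<phi> (fobj F x) (fobj_act F x)"
      unfolding gset_isomorphic_def by blast
    show "?\<phi> g c \<in> ?S" if "g \<in> carrier G" "c \<in> ?S" for g c
      using that inv[of c g] finite_gsetD(3)[OF E] by simp
  qed
  have "(\<Sum>j\<in>chains C n. gset_generator G {c \<in> ?E. ?\<pi> c = j} ?\<phi>) =
      (\<Sum>(x, gs)\<in>chains C n. gset_generator G (fobj F x) (fobj_act F x))"
    using fibre by (intro sum.cong) auto
  also have "\<dots> = (\<Sum>x\<in>obj C. \<Sum>gs\<in>chains_from C n x. gset_generator G (fobj F x) (fobj_act F x))"
    using finite_chains_from finite_obj by (simp add: chains_conv_Sigma category_axioms sum.Sigma)
  also have "\<dots> = (\<Sum>x\<in>obj C. pm_scale (num_chains C n x) (gset_generator G (fobj F x) (fobj_act F x)))"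
    by (simp add: pm.sum_constant_scale num_chains_def)
  finally show ?thesis
    using gset_generator_fibres[OF finC E, of ?\<pi>] inv by (force simp: chainE)
qed

theorem theorem2p31:
  fixes G :: "('g, 'y) monoid_scheme"
    and C :: "('o, 'm, 'z) cat_scheme"
    and F :: "('o, 'm, 'g, 'a, 'w) gset_functor_scheme"
  assumes "group G" and "finite (carrier G)"
    and "finite_category C" and "has_skeletal_Moebius_inversion C"
    and "functor_to_finite_gsets G C F"
  shows "has_series_Lefschetz_invariant G (grothendieck C F) \<and>
    series_Lefschetz_invariant G (grothendieck C F) =
      (\<Oplus>\<^bsub>burnside_ring G\<^esub>x \<in> obj C.
        skeletal_weighting C x \<odot>\<^bsub>burnside_ring G\<^esub> burnside_class G (fobj F x) (fobj_act F x))"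
proof -
  interpret finite_category C by fact
  let ?f = "lefschetz_series G (grothendieck C F)"
  define v where "v x = gset_generator G (fobj F x) (fobj_act F x)" for x
  have v: "v x \<in> free_gsets G" if "x \<in> obj C" for x
    unfolding v_def
    by (rule gset_generator_in_free_gsets[OF functor_to_finite_gsets.fobj_gset[OF assms(5) that]])
  have cls: "burnside_class G (fobj F x) (fobj_act F x) = burnside_coset G (v x)" for x
    by (simp add: v_def burnside_class_eq)
  obtain p q where q: "poly q (-1) \<noteq> 0"
    and p: "\<And>x. x \<in> obj C \<Longrightarrow>
      fps_of_poly (p x) = fps_of_poly q * Abs_fps (\<lambda>n. num_chains C n x)"
    using chain_series_rational[OF assms(4)] by blast
  have "q \<noteq> 0" using q by auto
  \<comment> \<open>As a Laurent series the fraction is the chain series itself, so its coefficients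
    vanish at negative indices.\<close>
  then have coeff: "fls_nth (fls_of_ratfun (p x) q) n = (if n < 0 then 0 else num_chains C (nat n) x)"
    if "x \<in> obj C" for x n
    by (simp add: fls_of_ratfun_def p[OF that] fls_times_fps_to_fls)
  let ?k = "\<lambda>x. poly (p x) (-1) / poly q (-1)"
  let ?v = "burnside_coset G (\<Sum>x\<in>obj C. pm_scale (?k x) (v x))"
  \<comment> \<open>The terms in \<open>value_at_minus_one\<close> are indexed by an initial segment
    of the naturals, so the objects are enumerated.\<close>
  obtain h where h: "bij_betw h {..<card (obj C)} (obj C)"
    using ex_bij_betw_nat_finite[OF finite_obj] by (auto simp: atLeast0LessThan)
  have fs: "(\<Oplus>\<^bsub>burnside_ring G\<^esub>i \<in> {..<card (obj C)}. c (h i) \<odot>\<^bsub>burnside_ring G\<^esub> burnside_coset G (v (h i))) =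
      burnside_coset G (\<Sum>x\<in>obj C. pm_scale (c x) (v x))" for c
    using h v bij_betwE[OF h] burnside_finsum_smult[of "{..<card (obj C)}" "\<lambda>i. v (h i)" G _ "\<lambda>i. c (h i)"]
      sum.reindex_bij_betw[OF h, of "\<lambda>x. pm_scale (c x) (v x)"] by simp
  have val: "value_at_minus_one G ?f ?v"
    unfolding value_at_minus_one_def
  proof (intro exI conjI allI impI)
    fix i assume "i < card (obj C)"
    then have "h i \<in> obj C" using bij_betwE[OF h] by auto
    then show "burnside_coset G (v (h i)) \<in> carrier (burnside_ring G)"
      using v by (simp add: burnside_carrier)
    show "\<not> [:1, 1:] dvd q" using q by (simp add: poly_eq_0_iff_dvd)
  next
    fix n :: int
    show "(if n < 0 then \<zero>\<^bsub>burnside_ring G\<^esub> else ?f (nat n)) =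
        (\<Oplus>\<^bsub>burnside_ring G\<^esub>i \<in> {..<card (obj C)}.
          fls_nth (fls_of_ratfun (p (h i)) q) n \<odot>\<^bsub>burnside_ring G\<^esub> burnside_coset G (v (h i)))"
      using functor_to_finite_gsets.gset_generator_chains[OF assms(5,3), of "nat n"]
      unfolding fs[of "\<lambda>x. fls_nth (fls_of_ratfun (p x) q) n"]
      by (simp add: coeff burnside_zero lefschetz_series_def burnside_class_eq burnside_coset_eq_iff v_def)
  next
    show "?v = (\<Oplus>\<^bsub>burnside_ring G\<^esub>i \<in> {..<card (obj C)}.
        ?k (h i) \<odot>\<^bsub>burnside_ring G\<^esub> burnside_coset G (v (h i)))"
      by (rule fs[symmetric])
  qed
  moreover have "?v = (\<Oplus>\<^bsub>burnside_ring G\<^esub>x \<in> obj C.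
      skeletal_weighting C x \<odot>\<^bsub>burnside_ring G\<^esub> burnside_class G (fobj F x) (fobj_act F x))"
    using burnside_finsum_smult[OF finite_obj v cls, where c = "skeletal_weighting C"]
    by (simp add: skeletal_weighting_eq_value[OF assms(4) q p])
  moreover have "series_Lefschetz_invariant G (grothendieck C F) = ?v"
    unfolding series_Lefschetz_invariant_def
    by (rule the_equality) (rule val, erule value_at_minus_one_unique[OF _ val])
  ultimately show ?thesis
    unfolding has_series_Lefschetz_invariant_def by auto
qed

end
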